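(* Let $s\ge2$ be an integer and let $\lambda_s=\frac{\Gamma(1/s)^s}{s^s\, s!}$. Let $B$ be a fixed (deterministic) sequence of nonnegative integers with counting function $B(n)=|\{b\in B: b\le n\}|$ satisfying $$\liminf_{n\to\infty}\frac{B(n)}{\log n}>\lambda_s^{-1}.$$ Let $A$ be a random sequence of pseudo $s$-th powers. Then, almost surely, every sufficiently large integer $n$ can be written in the form $$n=a_1+\cdots+a_s+b,\qquad \text{with pairwise distinct } a_1,\dots,a_s\in A \text{ and } b\in B.$$
   Context: A random sequence of pseudo $s$-th powers is defined as follows: on a probability space one takes independent Bernoulli random variables $(\xi_n)_{n\ge1}$ with $\mathbb P(\xi_n=1)=\frac1s n^{-1+1/s}$, and sets $A=\{n\ge1:\xi_n=1\}$. Thus the events $\{n\in A\}$ are independent and $\mathbb P(n\in A)=\frac1s n^{-1+1/s}$. *)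

theory Defs
  imports "HOL-Probability.Probability"
begin

text \<open>
  Bernoulli variables are boolean-valued, as in \<^const>\<open>bernoulli_pmf\<close>: the value \<^const>\<open>True\<close>
  plays the role of \<open>1\<close>. The parameter lies in \<open>(0, 1]\<close> for all \<open>s, n \<ge> 1\<close>, so the clamping
  done by \<^const>\<open>bernoulli_pmf\<close> has no effect. The value of \<open>\<xi>\<close> at index \<open>0\<close> is irrelevant.
\<close>

definition pseudo_power_indicators :: "nat \<Rightarrow> 'a measure \<Rightarrow> (nat \<Rightarrow> 'a \<Rightarrow> bool) \<Rightarrow> bool" where
  "pseudo_power_indicators s M \<xi> \<longleftrightarrow>
     prob_space M \<and>
     prob_space.indep_vars M (\<lambda>_. count_space UNIV) \<xi> {1..} \<and>
     (\<forall>n\<ge>1. distr M (count_space UNIV) (\<xi> n) =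
        measure_pmf (bernoulli_pmf (1 / real s * real n powr (- 1 + 1 / real s))))"

definition random_seq :: "(nat \<Rightarrow> 'a \<Rightarrow> bool) \<Rightarrow> 'a \<Rightarrow> nat set" where
  "random_seq \<xi> \<omega> = {n. n \<ge> 1 \<and> \<xi> n \<omega>}"

definition lambda_const :: "nat \<Rightarrow> real" where
  "lambda_const s = Gamma (1 / real s) ^ s / (real s ^ s * fact s)"

definition counting_fun :: "nat set \<Rightarrow> nat \<Rightarrow> nat" where
  "counting_fun B n = card {b \<in> B. b \<le> n}"

end

theory Submission
  imports Defs "HOL-Real_Asymp.Real_Asymp"
begin

text \<open>
  Fix \<open>n\<close> and choose about \<open>d log n\<close> elements \<open>b \<le> n/2\<close> of \<open>B\<close>, with \<open>d > 1/\<lambda>\<^sub>s\<close>. The expected number of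
  \<open>s\<close>-subsets of \<open>A\<close> with sum \<open>n - b\<close> is at least \<open>\<lambda>\<^sub>s - o(1)\<close>, while the expected number of pairs of
  distinct overlapping such subsets is \<open>O(n\<^bsup>-1/(2s)\<^esup> log\<^sup>2 n)\<close>. Janson's inequality therefore bounds the
  probability that \<open>n\<close> is not represented by \<open>O(n\<^bsup>-1-\<epsilon>\<^esup>)\<close>, and Borel--Cantelli applies.

  Both expectations reduce to Vandermonde's identity: up to a constant factor, \<open>n\<^bsup>-1+1/s\<^esup>\<close> is the
  coefficient of \<open>x\<^sup>n\<close> in \<open>(1 - x)\<^bsup>-1/s\<^esup>\<close>, and the \<open>s\<close>-th power of that series is \<open>1/(1 - x)\<close>, all of whose
  coefficients are \<open>1\<close>. Log-convexity of \<open>\<Gamma>\<close> makes the comparison an inequality in the direction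
  needed for the lower bound, with the exact constant \<open>\<Gamma>(1/s)\<close>.
\<close>

section \<open>Coefficients of negative binomial series\<close>

text \<open>The coefficient of \<open>x\<^sup>m\<close> in \<open>(1 - x)\<^bsup>-\<beta>\<^esup>\<close>.\<close>
definition mchoose :: "real \<Rightarrow> nat \<Rightarrow> real" where
  "mchoose \<beta> m = pochhammer \<beta> m / fact m"

lemma mchoose_0_right [simp]: "mchoose \<beta> 0 = 1"
  by (simp add: mchoose_def)

lemma mchoose_0_left: "mchoose 0 m = (if m = 0 then 1 else 0)"
  by (simp add: mchoose_def pochhammer_0_left)

lemma mchoose_1_left [simp]: "mchoose 1 m = 1"
  by (simp add: mchoose_def pochhammer_fact [symmetric])

lemma mchoose_nonneg [simp]: "\<beta> \<ge> 0 \<Longrightarrow> mchoose \<beta> m \<ge> 0"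
  by (auto simp: mchoose_def pochhammer_prod intro!: divide_nonneg_nonneg prod_nonneg)

lemma mchoose_Suc: "mchoose \<beta> (Suc m) = mchoose \<beta> m * ((\<beta> + m) / (m + 1))"
  by (simp add: mchoose_def pochhammer_Suc field_simps)

lemma mchoose_antimono:
  assumes "0 \<le> \<beta>" "\<beta> \<le> 1" "m \<le> n"
  shows "mchoose \<beta> n \<le> mchoose \<beta> m"
proof -
  have "mchoose \<beta> (Suc k) \<le> mchoose \<beta> k" for k
    unfolding mchoose_Suc using assms by (intro mult_left_le) auto
  then show ?thesis
    using assms(3) lift_Suc_antimono_le[of "mchoose \<beta>"] by blast
qed

text \<open>Vandermonde's identity: both sides are the coefficient of \<open>x^m\<close> in the
  product of \<open>(1 - x)\<close> to the powers \<open>-\<beta>\<close> and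
  \<open>-\<gamma>\<close>. The proof divides the binomial theorem for rising factorials by
  \<open>m!\<close>.\<close>

lemma mchoose_convolution:
  "(\<Sum>j\<le>m. mchoose \<beta> j * mchoose \<gamma> (m - j)) = mchoose (\<beta> + \<gamma>) m"
proof -
  have "mchoose (\<beta> + \<gamma>) m = (\<Sum>j\<le>m. of_nat (m choose j) * pochhammer \<beta> j * pochhammer \<gamma> (m - j)) / fact m"
    by (simp add: mchoose_def pochhammer_binomial_sum)
  also have "\<dots> = (\<Sum>j\<le>m. mchoose \<beta> j * mchoose \<gamma> (m - j))"
    unfolding sum_divide_distrib
    by (intro sum.cong refl) (simp add: mchoose_def binomial_fact)
  finally show ?thesis ..
qed

section \<open>Gamma function bounds for the coefficients\<close>

lemma Gamma_real_log_convex: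
  fixes x y t :: real
  assumes "x > 0" "y > 0" "0 \<le> t" "t \<le> 1"
  shows "Gamma ((1 - t) * x + t * y) \<le> Gamma x powr (1 - t) * Gamma y powr t"
proof -
  have pos: "(1 - t) * x + t * y > 0"
    using assms by (smt (verit) mult_nonneg_nonneg mult_pos_pos)
  have "ln (Gamma ((1 - t) * x + t * y)) \<le> (1 - t) * ln (Gamma x) + t * ln (Gamma y)"
    using convex_onD[OF log_convex_Gamma_real, of t x y] assms by simp
  also have "\<dots> = ln (Gamma x powr (1 - t) * Gamma y powr t)"
    using Gamma_real_pos[OF assms(1)] Gamma_real_pos[OF assms(2)] by (simp add: ln_mult ln_powr)
  finally show ?thesis
    using Gamma_real_pos[OF pos] Gamma_real_pos[OF assms(1)] Gamma_real_pos[OF assms(2)]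
    by (subst (asm) ln_le_cancel_iff) auto
qed

lemma mchoose_Gamma:
  assumes "\<beta> > 0"
  shows "mchoose \<beta> m = Gamma (\<beta> + m) / (Gamma \<beta> * Gamma (m + 1))"
proof -
  have "\<beta> \<notin> \<int>\<^sub>\<le>\<^sub>0" using assms by auto
  then show ?thesis
    by (simp add: mchoose_def pochhammer_Gamma Gamma_fact add.commute)
qed

text \<open>Log-convexity applies because \<open>\<beta> + m\<close> lies between \<open>m\<close>
  and \<open>m + 1\<close> with weight \<open>\<beta>\<close>, and
  \<open>Gamma (m + 1) = m * Gamma m\<close> removes the second endpoint. No constant is lost, which
  is what later preserves the exact value of \<open>lambda_const\<close>. At \<open>m = 0\<close>
  the right-hand side would be 0.\<close>

lemma mchoose_le_powr:
  assumes "0 < \<beta>" "\<beta> \<le> 1" "m > 0"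
  shows "Gamma \<beta> * mchoose \<beta> m \<le> real m powr (\<beta> - 1)"
proof -
  have G: "Gamma (real m) > 0" using assms by (intro Gamma_real_pos) auto
  have Suc: "Gamma (real m + 1) = m * Gamma m"
    using assms by (intro Gamma_plus1) auto
  have "Gamma (\<beta> + m) = Gamma ((1 - \<beta>) * m + \<beta> * (m + 1))"
    by (simp add: algebra_simps)
  also have "\<dots> \<le> Gamma m powr (1 - \<beta>) * Gamma (m + 1) powr \<beta>"
    using assms by (intro Gamma_real_log_convex) auto
  also have "Gamma (real (m + 1)) = m * Gamma m"
    using Suc by (simp add: add.commute)
  also have "Gamma m powr (1 - \<beta>) * (m * Gamma m) powr \<beta> = Gamma m * m powr \<beta>"
    using G by (simp add: powr_mult powr_diff)
  also have "\<dots> = m powr (\<beta> - 1) * Gamma (real m + 1)"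
    using assms Suc by (simp add: powr_diff)
  finally have "Gamma (\<beta> + m) \<le> m powr (\<beta> - 1) * Gamma (real m + 1)" .
  moreover have "Gamma (real m + 1) > 0" "Gamma \<beta> > 0"
    using assms by (auto intro!: Gamma_real_pos)
  ultimately show ?thesis
    using assms by (simp add: mchoose_Gamma divide_le_eq)
qed

text \<open>The companion bound: now \<open>m + 1\<close> lies between \<open>\<beta> + m\<close>
  and \<open>\<beta> + m + 1\<close>, with weight \<open>1 - \<beta>\<close>.\<close>

lemma mchoose_ge_powr:
  assumes "0 < \<beta>" "\<beta> \<le> 1"
  shows "real (m + 1) powr (\<beta> - 1) \<le> Gamma \<beta> * mchoose \<beta> m"
proof -
  have G: "Gamma (\<beta> + m) > 0" "Gamma \<beta> > 0" "Gamma (real m + 1) > 0"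
    using assms by (auto intro!: Gamma_real_pos)
  have "Gamma (real m + 1) = Gamma ((1 - (1 - \<beta>)) * (\<beta> + m) + (1 - \<beta>) * (\<beta> + m + 1))"
    by (simp add: algebra_simps)
  also have "\<dots> \<le> Gamma (\<beta> + m) powr (1 - (1 - \<beta>)) * Gamma (\<beta> + m + 1) powr (1 - \<beta>)"
    using assms by (intro Gamma_real_log_convex) auto
  also have "Gamma (\<beta> + m + 1) = (\<beta> + m) * Gamma (\<beta> + m)"
    using assms by (intro Gamma_plus1) auto
  also have "Gamma (\<beta> + m) powr (1 - (1 - \<beta>)) * ((\<beta> + m) * Gamma (\<beta> + m)) powr (1 - \<beta>)
      = Gamma (\<beta> + m) * (\<beta> + m) powr (1 - \<beta>)"
    using G assms by (simp add: powr_mult powr_diff)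
  also have "\<dots> \<le> Gamma (\<beta> + m) * real (m + 1) powr (1 - \<beta>)"
    using G assms by (intro mult_left_mono powr_mono2) auto
  finally have "Gamma (real m + 1) \<le> Gamma (\<beta> + m) * real (m + 1) powr (1 - \<beta>)" .
  moreover have "real (m + 1) powr (\<beta> - 1) = 1 / real (m + 1) powr (1 - \<beta>)"
    by (simp add: powr_diff)
  ultimately have "real (m + 1) powr (\<beta> - 1) \<le> Gamma (\<beta> + m) / Gamma (real m + 1)"
    using G by (simp add: pos_le_divide_eq pos_divide_le_eq add.commute)
  moreover have "Gamma \<beta> \<noteq> 0" using G by linarith
  ultimately show ?thesis
    using assms by (simp add: mchoose_Gamma)
qed

text \<open>The shift to \<open>m + 1\<close> makes the power law meaningful at
  \<open>m = 0\<close>. It costs a factor of at most 2, since \<open>m + 1 \<le> 2 * m\<close> for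
  positive \<open>m\<close>; the \<open>max\<close> with 1 in the constant covers
  \<open>m = 0\<close>.\<close>

lemma mchoose_upper:
  assumes "0 < \<beta>" "\<beta> \<le> 1"
  obtains C where "C > 0" "\<And>m. mchoose \<beta> m \<le> C * real (m + 1) powr (\<beta> - 1)"
proof
  define C where "C = max 1 (2 / Gamma \<beta>)"
  have G: "Gamma \<beta> > 0" using assms by (intro Gamma_real_pos)
  show "C > 0" by (simp add: C_def)
  show "mchoose \<beta> m \<le> C * real (m + 1) powr (\<beta> - 1)" for m
  proof (cases "m = 0")
    case False
    have "Gamma \<beta> * mchoose \<beta> m \<le> real m powr (\<beta> - 1)"
      using assms False by (intro mchoose_le_powr) auto
    also have "\<dots> \<le> (real (m + 1) / 2) powr (\<beta> - 1)"
      using assms False by (intro powr_mono2') auto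
    also have "\<dots> = 2 powr (1 - \<beta>) * real (m + 1) powr (\<beta> - 1)"
      by (simp add: powr_divide powr_diff)
    also have "\<dots> \<le> 2 powr 1 * real (m + 1) powr (\<beta> - 1)"
      using assms by (intro mult_right_mono powr_mono) auto
    finally have "mchoose \<beta> m \<le> 2 / Gamma \<beta> * real (m + 1) powr (\<beta> - 1)"
      using G by (simp add: field_simps)
    also have "\<dots> \<le> C * real (m + 1) powr (\<beta> - 1)"
      by (intro mult_right_mono) (auto simp: C_def)
    finally show ?thesis .
  qed (simp add: C_def)
qed

lemma mchoose_tendsto_0:
  assumes "0 \<le> \<beta>" "\<beta> < 1"
  shows "mchoose \<beta> \<longlonglongrightarrow> 0"
proof (cases "\<beta> = 0")
  case True
  then show ?thesis
    by (intro tendsto_eventually eventually_sequentiallyI[of 1]) (simp add: mchoose_0_left)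
next
  case False
  then obtain C where C: "C > 0" "\<And>m. mchoose \<beta> m \<le> C * real (m + 1) powr (\<beta> - 1)"
    using mchoose_upper[of \<beta>] assms by auto
  have "(\<lambda>m. C * real (m + 1) powr (\<beta> - 1)) \<longlonglongrightarrow> C * 0"
    using assms by (intro tendsto_mult tendsto_const tendsto_neg_powr
        filterlim_compose[OF filterlim_real_sequentially] filterlim_add_const_nat_at_top) auto
  then show ?thesis
    using C assms
    by (intro tendsto_sandwich[where f = "\<lambda>m. 0" and g = "mchoose \<beta>" and h = "\<lambda>m. C * real (m + 1) powr (\<beta> - 1)"]) auto
qed

text \<open>Serves the diagonal terms of a convolution: two equal summands \<open>m\<close> have
  total \<open>2 * m\<close>, so their joint weight can be charged to a single summand
  \<open>2 * m\<close>. One factor is bounded by 1, and doubling the argument of the other changes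
  it only by a constant.\<close>

lemma mchoose_square_le_double:
  assumes "0 < \<beta>" "\<beta> \<le> 1"
  obtains C where "C \<ge> 0" "\<And>m. mchoose \<beta> m ^ 2 \<le> C * mchoose \<beta> (2 * m)"
proof -
  obtain C where C: "C > 0" "\<And>m. mchoose \<beta> m \<le> C * real (m + 1) powr (\<beta> - 1)"
    using mchoose_upper[of \<beta>] assms by auto
  have G: "Gamma \<beta> > 0" using assms by (intro Gamma_real_pos)
  show ?thesis
  proof
    show "2 * C * Gamma \<beta> \<ge> 0" using C G by simp
    fix m
    have "mchoose \<beta> m \<le> mchoose \<beta> 0"
      using assms by (intro mchoose_antimono) auto
    then have "mchoose \<beta> m ^ 2 \<le> mchoose \<beta> m"
      using assms by (simp add: power2_eq_square mult_left_le)
    also have "\<dots> \<le> C * real (m + 1) powr (\<beta> - 1)" by (rule C)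
    also have "\<dots> \<le> C * (real (2 * m + 1) / 2) powr (\<beta> - 1)"
      using assms C by (intro mult_left_mono powr_mono2') auto
    also have "\<dots> = C * (2 powr (1 - \<beta>) * real (2 * m + 1) powr (\<beta> - 1))"
      by (simp add: powr_divide powr_diff)
    also have "\<dots> \<le> C * (2 powr 1 * (Gamma \<beta> * mchoose \<beta> (2 * m)))"
      using assms C mchoose_ge_powr[of \<beta> "2 * m"] by (intro mult_left_mono mult_mono powr_mono) auto
    finally show "mchoose \<beta> m ^ 2 \<le> 2 * C * Gamma \<beta> * mchoose \<beta> (2 * m)"
      by simp
  qed
qed

text \<open>Of the decay \<open>j\<^bsup>\<kappa>-1\<^esup>\<close> of one of the two factors with parameter \<open>\<kappa>\<close>, only \<open>j\<^bsup>-\<delta>\<^esup>\<close> is used. It lowers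
  the parameter of the other factor to \<open>\<kappa> - \<delta>\<close>, so that the sum becomes a convolution.\<close>
lemma mchoose_triple_sum:
  assumes "0 < \<delta>" "\<delta> < \<kappa>" "\<kappa> + \<delta> \<le> 1"
  obtains C where "C > 0"
    "\<And>m m'. m \<le> m' \<Longrightarrow>
       (\<Sum>t\<le>m. mchoose (1 - \<kappa>) t * mchoose \<kappa> (m - t) * mchoose \<kappa> (m' - t)) \<le> C * real (m + 1) powr (-\<delta>)"
proof -
  obtain C1 where C1: "C1 > 0" "\<And>m. mchoose \<kappa> m \<le> C1 * real (m + 1) powr (\<kappa> - 1)"
    using mchoose_upper[of \<kappa>] assms by auto
  obtain C2 where C2: "C2 > 0" "\<And>m. mchoose (1 - \<delta>) m \<le> C2 * real (m + 1) powr (1 - \<delta> - 1)"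
    using mchoose_upper[of "1 - \<delta>"] assms by auto
  have G: "Gamma (\<kappa> - \<delta>) > 0" using assms by (intro Gamma_real_pos) auto
  define C where "C = C1 ^ 2 * Gamma (\<kappa> - \<delta>)"
  have C0: "C > 0" using C1 G by (simp add: C_def)
  have sq: "mchoose \<kappa> j ^ 2 \<le> C * mchoose (\<kappa> - \<delta>) j" for j
  proof -
    have "mchoose \<kappa> j ^ 2 \<le> (C1 * real (j + 1) powr (\<kappa> - 1)) ^ 2"
      using C1 assms by (intro power_mono) auto
    also have "\<dots> = C1 ^ 2 * real (j + 1) powr (2 * (\<kappa> - 1))"
      by (simp add: power_mult_distrib powr_power mult.commute)
    \<comment> \<open>The comparison of exponents is exactly the hypothesis
      \<open>\<kappa> + \<delta> \<le> 1\<close>.\<close>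
    also have "\<dots> \<le> C1 ^ 2 * real (j + 1) powr (\<kappa> - \<delta> - 1)"
      using assms by (intro mult_left_mono powr_mono) auto
    also have "\<dots> \<le> C1 ^ 2 * (Gamma (\<kappa> - \<delta>) * mchoose (\<kappa> - \<delta>) j)"
      using assms by (intro mult_left_mono mchoose_ge_powr) auto
    finally show ?thesis by (simp add: C_def)
  qed
  show ?thesis
  proof
    show "C * C2 > 0" using C0 C2 by simp
    fix m m' :: nat assume "m \<le> m'"
    have "(\<Sum>t\<le>m. mchoose (1 - \<kappa>) t * mchoose \<kappa> (m - t) * mchoose \<kappa> (m' - t))
        \<le> (\<Sum>t\<le>m. mchoose (1 - \<kappa>) t * (C * mchoose (\<kappa> - \<delta>) (m - t)))"
    proof (intro sum_mono)
      fix t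
      have "mchoose \<kappa> (m - t) * mchoose \<kappa> (m' - t) \<le> mchoose \<kappa> (m - t) ^ 2"
        unfolding power2_eq_square using assms \<open>m \<le> m'\<close>
        by (intro mult_left_mono mchoose_antimono) auto
      also have "\<dots> \<le> C * mchoose (\<kappa> - \<delta>) (m - t)" by (rule sq)
      finally show "mchoose (1 - \<kappa>) t * mchoose \<kappa> (m - t) * mchoose \<kappa> (m' - t)
          \<le> mchoose (1 - \<kappa>) t * (C * mchoose (\<kappa> - \<delta>) (m - t))"
        unfolding mult.assoc using assms by (intro mult_left_mono) auto
    qed
    also have "\<dots> = C * mchoose (1 - \<delta>) m"
      using mchoose_convolution[of "1 - \<kappa>" "\<kappa> - \<delta>" m]
      by (simp add: mult.left_commute[of _ C] flip: sum_distrib_left)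
    also have "\<dots> \<le> C * (C2 * real (m + 1) powr (-\<delta>))"
      using C2(2)[of m] C0 by (intro mult_left_mono) auto
    finally show "(\<Sum>t\<le>m. mchoose (1 - \<kappa>) t * mchoose \<kappa> (m - t) * mchoose \<kappa> (m' - t))
        \<le> C * C2 * real (m + 1) powr (-\<delta>)" by (simp add: mult_ac)
  qed
qed

section \<open>Weighted counts of representations by distinct summands\<close>

text \<open>Sets rather than tuples make the summands distinct and unordered, which is the source of
  the factor \<open>fact s\<close> in \<open>lambda_const\<close>.\<close>

definition sum_sets :: "nat \<Rightarrow> nat \<Rightarrow> nat set set" where
  "sum_sets k m = {S. finite S \<and> 0 \<notin> S \<and> card S = k \<and> \<Sum>S = m}"

text \<open>If \<open>w a\<close> is the probability that \<open>a\<close> is chosen, independently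
  for all \<open>a\<close>, this is the expected number of sets in \<open>sum_sets k m\<close> all
  of whose elements are chosen.\<close>

definition rep_weight :: "(nat \<Rightarrow> real) \<Rightarrow> nat \<Rightarrow> nat \<Rightarrow> real" where
  "rep_weight w k m = (\<Sum>S\<in>sum_sets k m. prod w S)"

lemma sum_sets_subset: "sum_sets k m \<subseteq> Pow {1..m}"
proof
  fix S assume "S \<in> sum_sets k m"
  then have S: "finite S" "0 \<notin> S" "\<Sum>S = m" by (auto simp: sum_sets_def)
  then have "x \<le> m" if "x \<in> S" for x
    using member_le_sum[of x S "\<lambda>x. x"] that by auto
  moreover have "x \<ge> 1" if "x \<in> S" for x
    using S that by (cases x) auto
  ultimately show "S \<in> Pow {1..m}" by auto
qed

lemma finite_sum_sets [simp]: "finite (sum_sets k m)"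
  using sum_sets_subset by (rule finite_subset) simp

lemma sum_sets_pos: "S \<in> sum_sets k m \<Longrightarrow> a \<in> S \<Longrightarrow> a > 0"
  by (auto simp: sum_sets_def intro: gr0I)

lemma sum_sets_finite_pos: "S \<in> sum_sets k m \<Longrightarrow> finite S \<and> S \<subseteq> {1..}"
  using sum_sets_pos[of S k m] by (auto simp: sum_sets_def Suc_le_eq)

lemma prod_sum_sets_nonneg:
  fixes w :: "nat \<Rightarrow> real"
  assumes "\<And>a. a > 0 \<Longrightarrow> w a \<ge> 0" "T \<in> sum_sets k m"
  shows "prod w T \<ge> 0"
  using assms by (intro prod_nonneg) (blast dest: sum_sets_pos)

lemma rep_weight_nonneg: "(\<And>a. a > 0 \<Longrightarrow> w a \<ge> 0) \<Longrightarrow> rep_weight w k m \<ge> 0"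
  unfolding rep_weight_def by (intro sum_nonneg prod_sum_sets_nonneg)

lemma sum_sets_0: "sum_sets 0 m = (if m = 0 then {{}} else {})"
  by (auto simp: sum_sets_def)

lemma rep_weight_0: "rep_weight w 0 m = (if m = 0 then 1 else 0)"
  by (simp add: rep_weight_def sum_sets_0)

lemma sum_sets_1: "sum_sets (Suc 0) m = (if m = 0 then {} else {{m}})"
  by (auto simp: sum_sets_def card_1_singleton_iff)

lemma rep_weight_1: "rep_weight w (Suc 0) m = (if m = 0 then 0 else w m)"
  by (simp add: rep_weight_def sum_sets_1)

section \<open>Recursions obtained by splitting off one summand\<close>

lemma sum_sets_insert:
  assumes "T \<in> sum_sets k (m - a)" "a \<notin> T" "1 \<le> a" "a \<le> m"
  shows "insert a T \<in> sum_sets (Suc k) m"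
  using assms by (auto simp: sum_sets_def)

lemma sum_sets_remove:
  assumes "S \<in> sum_sets (Suc k) m" "a \<in> S"
  shows "S - {a} \<in> sum_sets k (m - a)"
  using assms by (auto simp: sum_sets_def sum_diff1_nat)

text \<open>Double counting of the pairs of a set \<open>S\<close> and a marked element
  \<open>a\<close> of \<open>S\<close>: each \<open>S\<close> has \<open>Suc k\<close> marked
  versions, and deleting the mark leaves a set \<open>T\<close> that avoids
  \<open>a\<close>.\<close>

lemma rep_weight_Suc:
  "real (Suc k) * rep_weight w (Suc k) m =
     (\<Sum>a=1..m. w a * (\<Sum>T\<in>{T \<in> sum_sets k (m - a). a \<notin> T}. prod w T))"
proof -
  have "real (Suc k) * rep_weight w (Suc k) m = (\<Sum>S\<in>sum_sets (Suc k) m. \<Sum>a\<in>S. prod w S)"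
    unfolding rep_weight_def sum_distrib_left
    by (intro sum.cong refl) (auto simp: sum_sets_def)
  also have "\<dots> = (\<Sum>(S, a)\<in>Sigma (sum_sets (Suc k) m) (\<lambda>S. S). prod w S)"
    by (intro sum.Sigma ballI finite_sum_sets) (simp add: sum_sets_def)
  also have "\<dots> = (\<Sum>(a, T)\<in>Sigma {1..m} (\<lambda>a. {T \<in> sum_sets k (m - a). a \<notin> T}). w a * prod w T)"
  proof (rule sum.reindex_bij_witness[of _ "\<lambda>(a, T). (insert a T, a)" "\<lambda>(S, a). (a, S - {a})"])
    fix x assume x: "x \<in> Sigma (sum_sets (Suc k) m) (\<lambda>S. S)"
    obtain S a where [simp]: "x = (S, a)" by fastforce
    have S: "S \<in> sum_sets (Suc k) m" "a \<in> S" using x by auto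
    show "(case case x of (S, a) \<Rightarrow> (a, S - {a}) of (a, T) \<Rightarrow> (insert a T, a)) = x"
      using S by auto
    show "(case x of (S, a) \<Rightarrow> (a, S - {a})) \<in> Sigma {1..m} (\<lambda>a. {T \<in> sum_sets k (m - a). a \<notin> T})"
      using S subsetD[OF sum_sets_subset S(1)] sum_sets_remove[OF S] by auto
    show "(case case x of (S, a) \<Rightarrow> (a, S - {a}) of (a, T) \<Rightarrow> w a * prod w T) = (case x of (S, a) \<Rightarrow> prod w S)"
      using S by (simp add: sum_sets_def prod.remove)
  next
    fix x assume x: "x \<in> Sigma {1..m} (\<lambda>a. {T \<in> sum_sets k (m - a). a \<notin> T})"
    obtain T a where [simp]: "x = (a, T)" by fastforce
    show "(case case x of (a, T) \<Rightarrow> (insert a T, a) of (S, a) \<Rightarrow> (a, S - {a})) = x"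
      using x by auto
    show "(case x of (a, T) \<Rightarrow> (insert a T, a)) \<in> Sigma (sum_sets (Suc k) m) (\<lambda>S. S)"
      using x sum_sets_insert by auto
  qed
  also have "\<dots> = (\<Sum>a=1..m. \<Sum>T\<in>{T \<in> sum_sets k (m - a). a \<notin> T}. w a * prod w T)"
    by (intro sum.Sigma[symmetric]) auto
  finally show ?thesis by (simp add: sum_distrib_left)
qed

lemma rep_weight_Suc_le:
  assumes "\<And>a. a > 0 \<Longrightarrow> w a \<ge> 0"
  shows "real (Suc k) * rep_weight w (Suc k) m \<le> (\<Sum>a=1..m. w a * rep_weight w k (m - a))"
  unfolding rep_weight_Suc unfolding rep_weight_def
  using assms by (intro sum_mono mult_left_mono sum_mono2) (auto intro: prod_sum_sets_nonneg)

lemma rep_weight_containing_le: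
  assumes w: "\<And>a. a > 0 \<Longrightarrow> w a \<ge> 0" and a: "a > 0"
  shows "(\<Sum>T\<in>{T \<in> sum_sets (Suc k) m. a \<in> T}. prod w T) \<le> (if a \<le> m then w a * rep_weight w k (m - a) else 0)"
proof (cases "a \<le> m")
  case True
  have "(\<Sum>T\<in>{T \<in> sum_sets (Suc k) m. a \<in> T}. prod w T) =
      (\<Sum>T\<in>{T \<in> sum_sets (Suc k) m. a \<in> T}. w a * prod w (T - {a}))"
    by (intro sum.cong refl) (auto simp: sum_sets_def prod.remove)
  also have "\<dots> = (\<Sum>T\<in>(\<lambda>T. T - {a}) ` {T \<in> sum_sets (Suc k) m. a \<in> T}. w a * prod w T)"
    by (subst sum.reindex) (auto simp: inj_on_def)
  also have "\<dots> \<le> (\<Sum>T\<in>sum_sets k (m - a). w a * prod w T)"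
    using w a by (intro sum_mono2) (auto intro: sum_sets_remove prod_sum_sets_nonneg mult_nonneg_nonneg)
  finally show ?thesis using True by (simp add: rep_weight_def sum_distrib_left)
next
  case False
  then have "{T \<in> sum_sets (Suc k) m. a \<in> T} = {}"
    using sum_sets_subset[of "Suc k" m] by fastforce
  then show ?thesis using False by (simp only: sum.empty) simp
qed

text \<open>The condition \<open>a \<notin> T\<close> is dropped from the recursion and the surplus
  subtracted. A set \<open>T\<close> containing \<open>a\<close> uses \<open>a\<close> a second
  time, so the remaining \<open>k\<close> elements sum to \<open>m - 2 * a\<close>.\<close>

lemma rep_weight_Suc_Suc_ge:
  assumes w: "\<And>a. a > 0 \<Longrightarrow> w a \<ge> 0"
  shows "real (Suc (Suc k)) * rep_weight w (Suc (Suc k)) m \<ge>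
    (\<Sum>a=1..m. w a * rep_weight w (Suc k) (m - a))
     - (\<Sum>a\<in>{a\<in>{1..m}. 2 * a \<le> m}. w a ^ 2 * rep_weight w k (m - 2 * a))"
proof -
  have *: "(\<Sum>T\<in>{T \<in> sum_sets (Suc k) (m - a). a \<notin> T}. prod w T) \<ge>
     rep_weight w (Suc k) (m - a) - (if 2 * a \<le> m then w a * rep_weight w k (m - 2 * a) else 0)"
    if "a \<in> {1..m}" for a
  proof -
    have "rep_weight w (Suc k) (m - a) =
       (\<Sum>T\<in>{T \<in> sum_sets (Suc k) (m - a). a \<notin> T}. prod w T)
       + (\<Sum>T\<in>{T \<in> sum_sets (Suc k) (m - a). a \<in> T}. prod w T)"
      unfolding rep_weight_def
      by (subst sum.union_disjoint [symmetric]) (auto intro!: sum.cong)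
    moreover have "(\<Sum>T\<in>{T \<in> sum_sets (Suc k) (m - a). a \<in> T}. prod w T)
       \<le> (if 2 * a \<le> m then w a * rep_weight w k (m - 2 * a) else 0)"
      using rep_weight_containing_le[of w a k "m - a"] w that
      by (auto simp: mult_2 split: if_splits)
    ultimately show ?thesis by linarith
  qed
  have "(\<Sum>a=1..m. w a * rep_weight w (Suc k) (m - a))
     - (\<Sum>a\<in>{a\<in>{1..m}. 2 * a \<le> m}. w a ^ 2 * rep_weight w k (m - 2 * a))
     = (\<Sum>a=1..m. w a * (rep_weight w (Suc k) (m - a) - (if 2 * a \<le> m then w a * rep_weight w k (m - 2 * a) else 0)))"
    by (subst sum.inter_filter)
       (auto simp: sum_subtractf [symmetric] algebra_simps power2_eq_square intro!: sum.cong)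
  also have "\<dots> \<le> (\<Sum>a=1..m. w a * (\<Sum>T\<in>{T \<in> sum_sets (Suc k) (m - a). a \<notin> T}. prod w T))"
    using w * by (intro sum_mono mult_left_mono) auto
  finally show ?thesis by (simp only: rep_weight_Suc)
qed

section \<open>Comparison of weighted counts with binomial coefficients\<close>

text \<open>Each step of the recursion is a convolution that adds \<open>\<alpha>\<close> to the
  parameter. The gain of \<open>1 / fact k\<close> is discarded, as only the order of magnitude
  matters here.\<close>

lemma rep_weight_upper:
  fixes \<alpha> :: real
  assumes "0 \<le> \<alpha>" and w: "\<And>a. a > 0 \<Longrightarrow> 0 \<le> w a" "\<And>a. a > 0 \<Longrightarrow> w a \<le> C * mchoose \<alpha> a" and "C \<ge> 0"
  shows "rep_weight w k m \<le> C ^ k * mchoose (k * \<alpha>) m"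
proof (induction k arbitrary: m)
  case 0
  then show ?case by (simp add: rep_weight_0 mchoose_0_left)
next
  case (Suc k)
  have "rep_weight w (Suc k) m \<le> real (Suc k) * rep_weight w (Suc k) m"
    using rep_weight_nonneg[of w "Suc k" m] w by (simp add: mult_le_cancel_right1)
  also have "\<dots> \<le> (\<Sum>a=1..m. w a * rep_weight w k (m - a))"
    using w by (intro rep_weight_Suc_le) auto
  also have "\<dots> \<le> (\<Sum>a=1..m. (C * mchoose \<alpha> a) * (C ^ k * mchoose (k * \<alpha>) (m - a)))"
    using Suc w assms by (intro sum_mono mult_mono) (auto intro: rep_weight_nonneg)
  also have "\<dots> \<le> (\<Sum>a\<le>m. (C * mchoose \<alpha> a) * (C ^ k * mchoose (k * \<alpha>) (m - a)))"
    using assms by (intro sum_mono2) (auto intro!: mult_nonneg_nonneg)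
  also have "\<dots> = C ^ Suc k * mchoose (\<alpha> + k * \<alpha>) m"
    by (simp add: mchoose_convolution [symmetric] sum_distrib_left mult_ac)
  finally show ?case by (simp add: algebra_simps)
qed

text \<open>Ordered tuples with repetition would give exactly
  \<open>mchoose (Suc k * \<alpha>) m\<close>. Excluding zero and repeated summands costs only terms
  whose parameter is smaller by \<open>\<alpha>\<close>, and the recursion preserves this gap. For
  \<open>\<alpha> = 1 / s\<close> and \<open>Suc k = s\<close> the main term is 1 and the error
  tends to 0.\<close>

lemma rep_weight_lower:
  fixes \<alpha> :: real
  assumes "0 < \<alpha>" "\<alpha> \<le> 1"
  shows "\<exists>D. \<forall>m. fact (Suc k) * rep_weight (mchoose \<alpha>) (Suc k) m
           \<ge> mchoose (Suc k * \<alpha>) m - D * mchoose (k * \<alpha>) m"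
proof (induction k)
  case 0
  show ?case
    by (rule exI[of _ 1]) (simp add: rep_weight_1 mchoose_0_left)
next
  case (Suc k)
  then obtain D where D: "\<And>m. fact (Suc k) * rep_weight (mchoose \<alpha>) (Suc k) m
           \<ge> mchoose (Suc k * \<alpha>) m - D * mchoose (k * \<alpha>) m" by blast
  \<comment> \<open>A nonnegative error constant is needed because the correction from the term
    \<open>a = 0\<close> is dropped below after being multiplied by it.\<close>
  have D': "fact (Suc k) * rep_weight (mchoose \<alpha>) (Suc k) m
           \<ge> mchoose (Suc k * \<alpha>) m - \<bar>D\<bar> * mchoose (k * \<alpha>) m" for m
    using D[of m] mult_right_mono[of D "\<bar>D\<bar>" "mchoose (k * \<alpha>) m"] assms by force
  obtain C where C: "C \<ge> 0" "\<And>m. mchoose \<alpha> m ^ 2 \<le> C * mchoose \<alpha> (2 * m)"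
    using mchoose_square_le_double[of \<alpha>] assms by blast
  have nn [simp]: "mchoose \<alpha> a \<ge> 0" "mchoose (real j * \<alpha>) a \<ge> 0" for a j
    using assms by auto
  \<comment> \<open>The full convolution also has the term \<open>a = 0\<close>, with weight
    \<open>mchoose \<alpha> 0 = 1\<close>. Removing it accounts for the 1 in the new constant
    \<open>1 + \<bar>D\<bar> + E\<close>.\<close>
  have split0: "(\<Sum>a=1..m. mchoose \<alpha> a * f (m - a)) = (\<Sum>a\<le>m. mchoose \<alpha> a * f (m - a)) - f m" for m f
    by (simp add: atMost_atLeast0 sum.atLeast_Suc_atMost[of 0])
  define E where "E = fact (Suc k) * C"
  have "fact (Suc (Suc k)) * rep_weight (mchoose \<alpha>) (Suc (Suc k)) m
       \<ge> mchoose (Suc (Suc k) * \<alpha>) m - (1 + \<bar>D\<bar> + E) * mchoose (Suc k * \<alpha>) m" for m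
  proof -
    have "(\<Sum>a\<in>{a\<in>{1..m}. 2 * a \<le> m}. mchoose \<alpha> a ^ 2 * rep_weight (mchoose \<alpha>) k (m - 2 * a))
      \<le> (\<Sum>a\<in>{a\<in>{1..m}. 2 * a \<le> m}. (C * mchoose \<alpha> (2 * a)) * mchoose (k * \<alpha>) (m - 2 * a))"
      using C rep_weight_upper[of \<alpha> "mchoose \<alpha>" 1 k] assms
      by (intro sum_mono mult_mono) (auto intro: rep_weight_nonneg)
    \<comment> \<open>The doubled summand becomes the index of a convolution, which is then
      completed from even \<open>j\<close> to all \<open>j\<close>.\<close>
    also have "\<dots> = (\<Sum>j\<in>(\<lambda>a. 2 * a) ` {a\<in>{1..m}. 2 * a \<le> m}. (C * mchoose \<alpha> j) * mchoose (k * \<alpha>) (m - j))"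
      by (subst sum.reindex) (auto simp: inj_on_def)
    also have "\<dots> \<le> (\<Sum>j\<le>m. (C * mchoose \<alpha> j) * mchoose (k * \<alpha>) (m - j))"
      using C by (intro sum_mono2) (auto intro!: mult_nonneg_nonneg)
    also have "\<dots> = C * mchoose (Suc k * \<alpha>) m"
      using mchoose_convolution[of \<alpha> "k * \<alpha>" m]
      by (simp add: mult.assoc distrib_right flip: sum_distrib_left)
    finally have sq: "(\<Sum>a\<in>{a\<in>{1..m}. 2 * a \<le> m}. mchoose \<alpha> a ^ 2 * rep_weight (mchoose \<alpha>) k (m - 2 * a))
      \<le> C * mchoose (Suc k * \<alpha>) m" .
    have "mchoose (Suc (Suc k) * \<alpha>) m - mchoose (Suc k * \<alpha>) m - \<bar>D\<bar> * mchoose (Suc k * \<alpha>) m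
        \<le> (\<Sum>a=1..m. mchoose \<alpha> a * mchoose (Suc k * \<alpha>) (m - a))
          - \<bar>D\<bar> * (\<Sum>a=1..m. mchoose \<alpha> a * mchoose (k * \<alpha>) (m - a))"
      unfolding split0 mchoose_convolution using assms
      by (simp add: algebra_simps)
    also have "\<dots> = (\<Sum>a=1..m. mchoose \<alpha> a * (mchoose (Suc k * \<alpha>) (m - a) - \<bar>D\<bar> * mchoose (k * \<alpha>) (m - a)))"
      by (simp add: sum_distrib_left sum_subtractf [symmetric] algebra_simps)
    also have "\<dots> \<le> (\<Sum>a=1..m. mchoose \<alpha> a * (fact (Suc k) * rep_weight (mchoose \<alpha>) (Suc k) (m - a)))"
      using D' by (intro sum_mono mult_left_mono) auto
    also have "\<dots> = fact (Suc k) * (\<Sum>a=1..m. mchoose \<alpha> a * rep_weight (mchoose \<alpha>) (Suc k) (m - a))"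
      by (simp add: sum_distrib_left mult_ac del: fact_Suc)
    also have "\<dots> \<le> fact (Suc k) * (real (Suc (Suc k)) * rep_weight (mchoose \<alpha>) (Suc (Suc k)) m + C * mchoose (Suc k * \<alpha>) m)"
      using rep_weight_Suc_Suc_ge[of "mchoose \<alpha>" k m] sq by (intro mult_left_mono) auto
    also have "\<dots> = fact (Suc (Suc k)) * rep_weight (mchoose \<alpha>) (Suc (Suc k)) m + E * mchoose (Suc k * \<alpha>) m"
      unfolding E_def fact_Suc[of "Suc k"] by (simp add: algebra_simps del: fact_Suc)
    finally show ?thesis by (simp add: algebra_simps del: fact_Suc of_nat_Suc)
  qed
  then show ?case by blast
qed

lemma rep_weight_scale_mono:
  assumes "\<And>a. a > 0 \<Longrightarrow> 0 \<le> v a" "\<And>a. a > 0 \<Longrightarrow> c * v a \<le> w a" "c \<ge> 0"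
  shows "c ^ k * rep_weight v k m \<le> rep_weight w k m"
  unfolding rep_weight_def sum_distrib_left
proof (intro sum_mono)
  fix S assume "S \<in> sum_sets k m"
  then have S: "card S = k" "\<And>a. a \<in> S \<Longrightarrow> a > 0" by (auto simp: sum_sets_def intro: gr0I)
  have "c ^ k * prod v S = (\<Prod>a\<in>S. c * v a)" by (simp add: prod.distrib S)
  also have "\<dots> \<le> prod w S" using assms S by (intro prod_mono) auto
  finally show "c ^ k * prod v S \<le> prod w S" .
qed

text \<open>A pair is encoded by its common part and its two differences. Equal cardinalities give
  both differences the same size \<open>k\<close>; overlap and distinctness place \<open>k\<close>
  strictly between 0 and \<open>s\<close>. The index \<open>t\<close> is the sum of the common
  part.\<close>

lemma overlapping_pairs_sum_le:
  assumes w: "\<And>a. a > 0 \<Longrightarrow> w a \<ge> 0" and "m \<le> m'"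
  shows "(\<Sum>(S, S')\<in>{(S, S') \<in> sum_sets s m \<times> sum_sets s m'. S \<noteq> S' \<and> S \<inter> S' \<noteq> {}}. prod w (S \<union> S'))
    \<le> (\<Sum>k=1..<s. \<Sum>t\<le>m. rep_weight w (s - k) t * rep_weight w k (m - t) * rep_weight w k (m' - t))"
    (is "(\<Sum>(S, S')\<in>?P. _) \<le> _")
proof -
  define Q where "Q = (SIGMA k:{1..<s}. SIGMA t:{..m}. sum_sets (s - k) t \<times> sum_sets k (m - t) \<times> sum_sets k (m' - t))"
  define g where "g = (\<lambda>(S :: nat set, S'). (card (S - S'), \<Sum>(S \<inter> S'), S \<inter> S', S - S', S' - S))"
  define h where "h = (\<lambda>(k :: nat, t :: nat, U, V, W). prod w U * prod w V * prod w W)"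
  have inj: "inj_on g ?P"
    by (rule inj_on_inverseI[of _ "\<lambda>(k, t, U, V, W). (U \<union> V, U \<union> W)"]) (auto simp: g_def)
  have img: "g ` ?P \<subseteq> Q"
  proof
    fix x assume "x \<in> g ` ?P"
    then obtain S S' where x: "x = g (S, S')" and S: "S \<in> sum_sets s m" "S' \<in> sum_sets s m'"
      and ne: "S \<noteq> S'" "S \<inter> S' \<noteq> {}" by auto
    have fin: "finite S" "finite S'" and cards: "card S = s" "card S' = s" 
      and sums: "\<Sum>S = m" "\<Sum>S' = m'" and zero: "0 \<notin> S" "0 \<notin> S'"
      using S by (auto simp: sum_sets_def)
    have c1: "card (S \<inter> S') + card (S - S') = s"
      using card_Int_Diff[OF fin(1), of S'] cards by simp
    have c2: "card (S \<inter> S') + card (S' - S) = s"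
      using card_Int_Diff[OF fin(2), of S] cards by (simp add: Int_commute)
    have c3: "card (S \<inter> S') > 0" using ne fin by (simp add: card_gt_0_iff)
    have c4: "card (S - S') > 0"
    proof (rule ccontr)
      assume "\<not> ?thesis"
      then have "S \<subseteq> S'" using fin by auto
      then have "S = S'" using fin cards by (intro card_subset_eq) auto
      then show False using ne by simp
    qed
    have s1: "\<Sum>(S \<inter> S') + \<Sum>(S - S') = m"
      using sum.Int_Diff[OF fin(1), of "\<lambda>x. x" S'] sums by simp
    have s2: "\<Sum>(S \<inter> S') + \<Sum>(S' - S) = m'"
      using sum.Int_Diff[OF fin(2), of "\<lambda>x. x" S] sums by (simp add: Int_commute)
    show "x \<in> Q"
      using c1 c2 c3 c4 s1 s2 fin zero unfolding x g_def Q_def sum_sets_def by auto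
  qed
  have finQ: "finite Q" unfolding Q_def by (intro finite_SigmaI finite_cartesian_product) auto
  have "(\<Sum>(S, S')\<in>?P. prod w (S \<union> S')) = (\<Sum>x\<in>?P. h (g x))"
  proof (intro sum.cong refl, clarify)
    fix S S' assume S: "S \<in> sum_sets s m" "S' \<in> sum_sets s m'"
    have "S \<union> S' = (S \<inter> S') \<union> (S - S') \<union> (S' - S)" by auto
    moreover have "prod w \<dots> = prod w (S \<inter> S') * prod w (S - S') * prod w (S' - S)"
      using S by (subst prod.union_disjoint; (subst prod.union_disjoint)?) (auto simp: sum_sets_def)
    ultimately show "prod w (S \<union> S') = h (g (S, S'))" by (simp add: h_def g_def)
  qed
  also have "\<dots> = (\<Sum>x\<in>g ` ?P. h x)" using inj by (simp add: sum.reindex)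
  \<comment> \<open>The three parts range independently over \<open>Q\<close>, without being
    disjoint, so \<open>Q\<close> may contain triples that come from no pair.\<close>
  also have "\<dots> \<le> (\<Sum>x\<in>Q. h x)"
  proof (intro sum_mono2 finQ img)
    show "h x \<ge> 0" if "x \<in> Q - g ` ?P" for x
      using that w unfolding Q_def h_def
      by (auto intro!: mult_nonneg_nonneg intro: prod_sum_sets_nonneg)
  qed
  also have "\<dots> = (\<Sum>k=1..<s. \<Sum>t\<le>m. rep_weight w (s - k) t * rep_weight w k (m - t) * rep_weight w k (m' - t))"
  proof -
    have "(\<Sum>x\<in>Q. h x) = (\<Sum>k=1..<s. \<Sum>t\<le>m.
        \<Sum>x\<in>sum_sets (s - k) t \<times> sum_sets k (m - t) \<times> sum_sets k (m' - t). h (k, t, x))"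
      unfolding Q_def by (simp add: sum.Sigma split_def)
    also have "\<dots> = (\<Sum>k=1..<s. \<Sum>t\<le>m. rep_weight w (s - k) t * rep_weight w k (m - t) * rep_weight w k (m' - t))"
      unfolding h_def rep_weight_def prod.case
      by (intro sum.cong refl)
         (simp add: sum.cartesian_product [symmetric] sum_distrib_left [symmetric] sum_distrib_right [symmetric])
    finally show ?thesis .
  qed
  finally show ?thesis .
qed

section \<open>Janson's inequality\<close>

context prob_space
begin

context
  fixes \<xi> :: "'i \<Rightarrow> 'a \<Rightarrow> bool"
begin

definition all_true :: "'i set \<Rightarrow> 'a set" where
  "all_true S = {\<omega> \<in> space M. \<forall>i\<in>S. \<xi> i \<omega>}"

text \<open>The event that no member of \<open>F\<close> is contained in the random set of true
  indices.\<close>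

definition none_all_true :: "'i set set \<Rightarrow> 'a set" where
  "none_all_true F = {\<omega> \<in> space M. \<forall>S\<in>F. \<exists>i\<in>S. \<not> \<xi> i \<omega>}"

context
  fixes I :: "'i set"
  assumes indep: "indep_vars (\<lambda>_. count_space UNIV) \<xi> I"
begin

section \<open>Independence of events that depend on finitely many coordinates\<close>

lemma measurable_indicator: "i \<in> I \<Longrightarrow> \<xi> i \<in> measurable M (count_space UNIV)"
  using indep by (auto simp: indep_vars_def)

lemma cylinder_sets:
  assumes "finite J" "J \<subseteq> I"
  shows "{\<omega> \<in> space M. \<forall>i\<in>J. \<xi> i \<omega> \<in> A i} \<in> events"
proof -
  have "{\<omega> \<in> space M. \<xi> i \<omega> \<in> A i} \<in> events" if "i \<in> J" for i
    using measurable_sets[OF measurable_indicator[of i], of "A i"] assms that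
    by (auto simp: vimage_def Int_def conj_commute)
  then show ?thesis using assms by (intro sets.sets_Collect_finite_All) auto
qed

lemma prob_cylinder:
  assumes "finite J" "J \<subseteq> I"
  shows "prob {\<omega> \<in> space M. \<forall>i\<in>J. \<xi> i \<omega> \<in> A i} = (\<Prod>i\<in>J. prob {\<omega> \<in> space M. \<xi> i \<omega> \<in> A i})"
proof (cases "J = {}")
  case True
  then show ?thesis by (simp add: prob_space)
next
  case False
  have "{\<omega> \<in> space M. \<forall>i\<in>J. \<xi> i \<omega> \<in> A i} = (\<Inter>i\<in>J. \<xi> i -` A i \<inter> space M)"
    using False by auto
  moreover have "prob \<dots> = (\<Prod>i\<in>J. prob (\<xi> i -` A i \<inter> space M))"
    using indep False assms by (intro indep_varsD) auto
  moreover have "\<xi> i -` A i \<inter> space M = {\<omega> \<in> space M. \<xi> i \<omega> \<in> A i}" for i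
    by auto
  ultimately show ?thesis by simp
qed

lemma all_true_sets: "finite T \<Longrightarrow> T \<subseteq> I \<Longrightarrow> all_true T \<in> events"
  using cylinder_sets[of T "\<lambda>_. {True}"] by (simp add: all_true_def)

lemma prob_all_true:
  assumes "finite S" "S \<subseteq> I"
  shows "prob (all_true S) = (\<Prod>i\<in>S. prob {\<omega> \<in> space M. \<xi> i \<omega>})"
  using prob_cylinder[OF assms, of "\<lambda>_. {True}"] by (simp add: all_true_def)

lemma none_all_true_sets:
  assumes "finite F" "\<And>S. S \<in> F \<Longrightarrow> finite S \<and> S \<subseteq> I"
  shows "none_all_true F \<in> events"
proof -
  have "none_all_true F = space M - (\<Union>S\<in>F. all_true S)"
    by (auto simp: none_all_true_def all_true_def)
  also have "\<dots> \<in> events"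
    using assms by (intro sets.compl_sets sets.finite_UN all_true_sets) auto
  finally show ?thesis .
qed

lemma pattern_eq_cylinder:
  assumes "X \<subseteq> K" "T \<inter> K = {}"
  shows "{\<omega> \<in> space M. (\<forall>i\<in>T. \<xi> i \<omega>) \<and> {i\<in>K. \<xi> i \<omega>} = X} =
    {\<omega> \<in> space M. \<forall>i\<in>T \<union> K. \<xi> i \<omega> \<in> (if i \<in> T then {True} else {i \<in> X})}"
  using assms by auto

text \<open>An event depending only on the coordinates in the finite set \<open>K\<close> is a
  finite disjoint union over the possible sets \<open>X\<close> of true coordinates, each piece
  being a cylinder.\<close>

lemma pattern_sum:
  assumes "finite T" "finite K" "T \<union> K \<subseteq> I" "T \<inter> K = {}"
  shows "{\<omega> \<in> space M. (\<forall>i\<in>T. \<xi> i \<omega>) \<and> Q {i\<in>K. \<xi> i \<omega>}} \<in> events"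
    and "prob {\<omega> \<in> space M. (\<forall>i\<in>T. \<xi> i \<omega>) \<and> Q {i\<in>K. \<xi> i \<omega>}} =
      (\<Sum>X\<in>{X\<in>Pow K. Q X}. prob {\<omega> \<in> space M. (\<forall>i\<in>T. \<xi> i \<omega>) \<and> {i\<in>K. \<xi> i \<omega>} = X})"
proof -
  have eq: "{\<omega> \<in> space M. (\<forall>i\<in>T. \<xi> i \<omega>) \<and> Q {i\<in>K. \<xi> i \<omega>}} =
    (\<Union>X\<in>{X\<in>Pow K. Q X}. {\<omega> \<in> space M. (\<forall>i\<in>T. \<xi> i \<omega>) \<and> {i\<in>K. \<xi> i \<omega>} = X})"
    by auto
  have meas: "{\<omega> \<in> space M. (\<forall>i\<in>T. \<xi> i \<omega>) \<and> {i\<in>K. \<xi> i \<omega>} = X} \<in> events" if "X \<in> Pow K" for X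
    using that assms by (subst pattern_eq_cylinder; (intro cylinder_sets)?) auto
  show "{\<omega> \<in> space M. (\<forall>i\<in>T. \<xi> i \<omega>) \<and> Q {i\<in>K. \<xi> i \<omega>}} \<in> events"
    unfolding eq using assms meas by (intro sets.finite_UN) auto
  show "prob {\<omega> \<in> space M. (\<forall>i\<in>T. \<xi> i \<omega>) \<and> Q {i\<in>K. \<xi> i \<omega>}} =
      (\<Sum>X\<in>{X\<in>Pow K. Q X}. prob {\<omega> \<in> space M. (\<forall>i\<in>T. \<xi> i \<omega>) \<and> {i\<in>K. \<xi> i \<omega>} = X})"
    unfolding eq using assms meas
    by (intro finite_measure_finite_Union) (auto simp: disjoint_family_on_def)
qed

lemma all_true_indep_pattern:
  assumes "finite T" "finite K" "T \<union> K \<subseteq> I" "T \<inter> K = {}"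
  shows "prob {\<omega> \<in> space M. (\<forall>i\<in>T. \<xi> i \<omega>) \<and> Q {i\<in>K. \<xi> i \<omega>}} =
    prob (all_true T) * prob {\<omega> \<in> space M. Q {i\<in>K. \<xi> i \<omega>}}"
proof -
  have *: "prob {\<omega> \<in> space M. (\<forall>i\<in>T. \<xi> i \<omega>) \<and> {i\<in>K. \<xi> i \<omega>} = X} =
      prob (all_true T) * prob {\<omega> \<in> space M. {i\<in>K. \<xi> i \<omega>} = X}" if "X \<subseteq> K" for X
  proof -
    have "prob {\<omega> \<in> space M. (\<forall>i\<in>T. \<xi> i \<omega>) \<and> {i\<in>K. \<xi> i \<omega>} = X} =
       (\<Prod>i\<in>T \<union> K. prob {\<omega> \<in> space M. \<xi> i \<omega> \<in> (if i \<in> T then {True} else {i \<in> X})})"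
      using assms that by (simp only: pattern_eq_cylinder prob_cylinder finite_Un)
    also have "\<dots> = (\<Prod>i\<in>T. prob {\<omega> \<in> space M. \<xi> i \<omega> \<in> {True}}) *
        (\<Prod>i\<in>K. prob {\<omega> \<in> space M. \<xi> i \<omega> \<in> {i \<in> X}})"
      using assms by (subst prod.union_disjoint) (auto intro!: arg_cong2[of _ _ _ _ "(*)"] prod.cong)
    also have "(\<Prod>i\<in>T. prob {\<omega> \<in> space M. \<xi> i \<omega> \<in> {True}}) = prob (all_true T)"
      using assms by (simp add: prob_all_true)
    also have "(\<Prod>i\<in>K. prob {\<omega> \<in> space M. \<xi> i \<omega> \<in> {i \<in> X}}) = prob {\<omega> \<in> space M. {i\<in>K. \<xi> i \<omega>} = X}"
      using assms pattern_eq_cylinder[OF that, of "{}"] prob_cylinder[of K "\<lambda>i. {i \<in> X}"] by simp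
    finally show ?thesis .
  qed
  have "prob {\<omega> \<in> space M. (\<forall>i\<in>T. \<xi> i \<omega>) \<and> Q {i\<in>K. \<xi> i \<omega>}} =
      (\<Sum>X\<in>{X\<in>Pow K. Q X}. prob (all_true T) * prob {\<omega> \<in> space M. {i\<in>K. \<xi> i \<omega>} = X})"
    using * by (subst pattern_sum[OF assms]) auto
  also have "\<dots> = prob (all_true T) * prob {\<omega> \<in> space M. Q {i\<in>K. \<xi> i \<omega>}}"
    using assms pattern_sum(2)[of "{}" K Q] by (simp add: sum_distrib_left)
  finally show ?thesis .
qed

lemma prob_all_true_none_indep:
  assumes "finite T" "T \<subseteq> I" "finite F" "\<And>S. S \<in> F \<Longrightarrow> finite S \<and> S \<subseteq> I \<and> S \<inter> T = {}"
  shows "prob (all_true T \<inter> none_all_true F) = prob (all_true T) * prob (none_all_true F)"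
proof -
  define Q where "Q = (\<lambda>X. \<forall>S\<in>F. \<exists>i\<in>S. i \<notin> X)"
  have eq: "{\<omega> \<in> space M. Q {i\<in>\<Union>F. \<xi> i \<omega>}} = none_all_true F"
    by (auto simp: Q_def none_all_true_def)
  then have "all_true T \<inter> none_all_true F = {\<omega> \<in> space M. (\<forall>i\<in>T. \<xi> i \<omega>) \<and> Q {i\<in>\<Union>F. \<xi> i \<omega>}}"
    by (auto simp: all_true_def)
  also have "prob \<dots> = prob (all_true T) * prob {\<omega> \<in> space M. Q {i\<in>\<Union>F. \<xi> i \<omega>}}"
    using assms by (intro all_true_indep_pattern) auto
  finally show ?thesis by (simp only: eq)
qed

text \<open>On \<open>all_true T\<close> the sets in \<open>F\<close> may be replaced by their differences with \<open>T\<close>. The resulting event is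
  independent of \<open>all_true T\<close> and smaller than \<open>none_all_true F\<close>; this is the special case of
  Harris' inequality that Janson's inequality needs.\<close>
lemma prob_all_true_none_le:
  assumes "finite T" "T \<subseteq> I" "finite F" "\<And>S. S \<in> F \<Longrightarrow> finite S \<and> S \<subseteq> I"
  shows "prob (all_true T \<inter> none_all_true F) \<le> prob (all_true T) * prob (none_all_true F)"
proof -
  define Q where "Q = (\<lambda>X. \<forall>S\<in>F. \<exists>i\<in>S. i \<notin> X \<union> T)"
  have "all_true T \<inter> none_all_true F = {\<omega> \<in> space M. (\<forall>i\<in>T. \<xi> i \<omega>) \<and> Q {i\<in>\<Union>F - T. \<xi> i \<omega>}}"
    unfolding Q_def none_all_true_def all_true_def by blast
  also have "prob \<dots> = prob (all_true T) * prob {\<omega> \<in> space M. Q {i\<in>\<Union>F - T. \<xi> i \<omega>}}"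
    using assms by (intro all_true_indep_pattern) auto
  also have "\<dots> \<le> prob (all_true T) * prob (none_all_true F)"
  proof (intro mult_left_mono finite_measure_mono)
    show "{\<omega> \<in> space M. Q {i\<in>\<Union>F - T. \<xi> i \<omega>}} \<subseteq> none_all_true F"
      by (auto simp: Q_def none_all_true_def)
  qed (use assms in \<open>auto intro: none_all_true_sets\<close>)
  finally show ?thesis .
qed

text \<open>Members of \<open>F\<close> disjoint from \<open>S\<close> are independent of
  \<open>all_true S\<close>; those that meet \<open>S\<close> enter only through a union bound,
  which produces \<open>D\<close>. Thus, given that \<open>F\<close> is avoided, \<open>S\<close> is
  all true with conditional probability at least \<open>prob (all_true S) - D\<close>.\<close>

lemma Janson_step:
  assumes F: "finite F" "\<And>S. S \<in> F \<Longrightarrow> finite S \<and> S \<subseteq> I" and S: "finite S" "S \<subseteq> I"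
  defines "D \<equiv> (\<Sum>S'\<in>{S'\<in>F. S \<inter> S' \<noteq> {}}. prob (all_true (S \<union> S')))"
  shows "prob (none_all_true (insert S F)) \<le> prob (none_all_true F) * exp (- prob (all_true S) + D)"
proof -
  define N where "N = none_all_true F"
  define F0 F1 where "F0 = {S'\<in>F. S \<inter> S' = {}}" and "F1 = {S'\<in>F. S \<inter> S' \<noteq> {}}"
  define N0 where "N0 = none_all_true F0"
  have [measurable]: "N \<in> events" "N0 \<in> events" "all_true S \<in> events"
    unfolding N_def N0_def F0_def using assms by (auto intro!: none_all_true_sets all_true_sets)
  have meas: "all_true (S \<union> S') \<inter> N0 \<in> events" if "S' \<in> F1" for S'
    using that assms by (intro sets.Int all_true_sets) (auto simp: F1_def)
  have sub: "N \<subseteq> N0" by (auto simp: N_def N0_def F0_def none_all_true_def)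
  have ins: "none_all_true (insert S F) = N - (all_true S \<inter> N)"
    by (auto simp: N_def none_all_true_def all_true_def)
  have PN: "prob (none_all_true (insert S F)) = prob N - prob (all_true S \<inter> N)"
    unfolding ins by (intro finite_measure_Diff) auto
  \<comment> \<open>If \<open>S\<close> is all true and \<open>F0\<close> is avoided, then either
    all of \<open>F\<close> is avoided or some member of \<open>F1\<close> is all true together with
    \<open>S\<close>.\<close>
  have "all_true S \<inter> N0 \<subseteq> (all_true S \<inter> N) \<union> (\<Union>S'\<in>F1. all_true (S \<union> S') \<inter> N0)"
    by (auto simp: N_def N0_def F0_def F1_def none_all_true_def all_true_def)
  then have "prob (all_true S \<inter> N0) \<le> prob ((all_true S \<inter> N) \<union> (\<Union>S'\<in>F1. all_true (S \<union> S') \<inter> N0))"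
    using F meas by (intro finite_measure_mono sets.Un sets.finite_UN) (auto simp: F1_def)
  also have "\<dots> \<le> prob (all_true S \<inter> N) + prob (\<Union>S'\<in>F1. all_true (S \<union> S') \<inter> N0)"
    using F meas by (intro measure_Un_le sets.finite_UN) (auto simp: F1_def)
  also have "prob (\<Union>S'\<in>F1. all_true (S \<union> S') \<inter> N0) \<le> (\<Sum>S'\<in>F1. prob (all_true (S \<union> S') \<inter> N0))"
    using F meas by (intro finite_measure_subadditive_finite) (auto simp: F1_def)
  also have "\<dots> \<le> (\<Sum>S'\<in>F1. prob (all_true (S \<union> S')) * prob N0)"
    unfolding N0_def using assms
    by (intro sum_mono prob_all_true_none_le) (auto simp: F0_def F1_def)
  also have "\<dots> = D * prob N0" by (simp add: D_def F1_def sum_distrib_right)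
  also have "prob (all_true S \<inter> N0) = prob (all_true S) * prob N0"
    unfolding N0_def using assms by (intro prob_all_true_none_indep) (auto simp: F0_def)
  finally have lower: "(prob (all_true S) - D) * prob N0 \<le> prob (all_true S \<inter> N)"
    by (simp add: algebra_simps)
  \<comment> \<open>Passing from \<open>N0\<close> to the smaller event \<open>N\<close> needs a
    nonnegative coefficient; with a negative one the left-hand side is at most 0 anyway.\<close>
  have "(prob (all_true S) - D) * prob N \<le> prob (all_true S \<inter> N)"
  proof (cases "prob (all_true S) - D \<ge> 0")
    case True
    have "(prob (all_true S) - D) * prob N \<le> (prob (all_true S) - D) * prob N0"
      using True sub by (intro mult_left_mono finite_measure_mono) auto
    with lower show ?thesis by linarith
  next
    case False
    then have "(prob (all_true S) - D) * prob N \<le> 0" by (intro mult_nonpos_nonneg) auto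
    then show ?thesis by (meson measure_nonneg order_trans)
  qed
  then have "prob (none_all_true (insert S F)) \<le> prob N * (1 + (- prob (all_true S) + D))"
    unfolding PN by (simp add: algebra_simps)
  also have "\<dots> \<le> prob N * exp (- prob (all_true S) + D)"
    by (intro mult_left_mono exp_ge_add_one_self) auto
  finally show ?thesis by (simp add: N_def)
qed

text \<open>Induction on \<open>F\<close>, inserting one set at a time. The correction runs over
  ordered pairs, without the customary factor 1/2; this costs nothing when it stays bounded.\<close>

theorem Janson_inequality:
  assumes "finite F" "\<And>S. S \<in> F \<Longrightarrow> finite S \<and> S \<subseteq> I"
  shows "prob (none_all_true F) \<le> exp (- (\<Sum>S\<in>F. prob (all_true S)) +
    (\<Sum>(S, S')\<in>{(S, S') \<in> F \<times> F. S \<noteq> S' \<and> S \<inter> S' \<noteq> {}}. prob (all_true (S \<union> S'))))"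
  using assms
proof (induction F rule: finite_induct)
  case empty
  then show ?case by simp
next
  case (insert S F)
  define P where "P F = {(S, S') \<in> F \<times> F. S \<noteq> S' \<and> S \<inter> S' \<noteq> {}}" for F :: "'i set set"
  define D where "D = (\<Sum>S'\<in>{S'\<in>F. S \<inter> S' \<noteq> {}}. prob (all_true (S \<union> S')))"
  let ?f = "\<lambda>(S, S'). prob (all_true (S \<union> S'))"
  have finP: "finite (P F)" if "finite F" for F :: "'i set set"
    using that by (auto simp: P_def intro: finite_subset[of _ "F \<times> F"])
  have "D = (\<Sum>x\<in>Pair S ` {S'\<in>F. S \<inter> S' \<noteq> {}}. ?f x)"
    unfolding D_def by (subst sum.reindex) (auto simp: inj_on_def)
  \<comment> \<open>The new pairs are counted only with \<open>S\<close> in first position; the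
    reversed pairs merely enlarge the right-hand side in the next step.\<close>
  then have "(\<Sum>x\<in>P F. ?f x) + D = (\<Sum>x\<in>P F \<union> Pair S ` {S'\<in>F. S \<inter> S' \<noteq> {}}. ?f x)"
    using insert.hyps finP by (subst sum.union_disjoint) (auto simp: P_def)
  also have "\<dots> \<le> (\<Sum>x\<in>P (insert S F). ?f x)"
    using insert.hyps by (intro sum_mono2 finP) (auto simp: P_def)
  finally have le: "(\<Sum>x\<in>P F. ?f x) + D \<le> (\<Sum>x\<in>P (insert S F). ?f x)" .
  have "prob (none_all_true (insert S F)) \<le> prob (none_all_true F) * exp (- prob (all_true S) + D)"
    unfolding D_def using insert by (intro Janson_step) auto
  also have "\<dots> \<le> exp (- (\<Sum>S\<in>F. prob (all_true S)) + (\<Sum>x\<in>P F. ?f x)) * exp (- prob (all_true S) + D)"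
    using insert unfolding P_def by (intro mult_right_mono insert.IH) auto
  also have "\<dots> = exp (- (\<Sum>S\<in>insert S F. prob (all_true S)) + ((\<Sum>x\<in>P F. ?f x) + D))"
    using insert.hyps by (simp add: exp_add [symmetric] algebra_simps)
  also have "\<dots> \<le> exp (- (\<Sum>S\<in>insert S F. prob (all_true S)) + (\<Sum>x\<in>P (insert S F). ?f x))"
    using le by simp
  finally show ?case by (simp only: P_def)
qed

end

end

end

section \<open>Pseudo powers\<close>

definition pseudo_power_prob :: "nat \<Rightarrow> nat \<Rightarrow> real" where
  "pseudo_power_prob s n = 1 / real s * real n powr (- 1 + 1 / real s)"

lemma pseudo_power_prob_nonneg [simp]: "pseudo_power_prob s n \<ge> 0"
  by (simp add: pseudo_power_prob_def)

section \<open>Comparison of the probabilities with binomial coefficients\<close>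

lemma pseudo_power_prob_le_1:
  assumes "s \<ge> 1" "n \<ge> 1"
  shows "pseudo_power_prob s n \<le> 1"
proof -
  have "real n powr (- 1 + 1 / real s) \<le> real n powr 0"
    using assms by (intro powr_mono) (auto simp: divide_le_eq)
  then show ?thesis
    using assms unfolding pseudo_power_prob_def by (intro mult_le_one) auto
qed

lemma pseudo_power_prob_ge:
  assumes "s \<ge> 1" "n > 0"
  shows "1 / real s * Gamma (1 / real s) * mchoose (1 / real s) n \<le> pseudo_power_prob s n"
proof -
  have "Gamma (1 / real s) * mchoose (1 / real s) n \<le> real n powr (1 / real s - 1)"
    using assms by (intro mchoose_le_powr) auto
  then show ?thesis
    using assms by (simp add: pseudo_power_prob_def divide_simps)
qed

text \<open>The factor 2 is harmless: this bound is used only for the overlap terms, where constants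
  do not matter.\<close>

lemma pseudo_power_prob_le:
  assumes "s \<ge> 1" "n > 0"
  shows "pseudo_power_prob s n \<le> 2 / real s * Gamma (1 / real s) * mchoose (1 / real s) n"
proof -
  define \<alpha> where "\<alpha> = 1 / real s"
  have \<alpha>: "0 < \<alpha>" "\<alpha> \<le> 1" using assms by (auto simp: \<alpha>_def)
  have "real n powr (\<alpha> - 1) \<le> (real (n + 1) / 2) powr (\<alpha> - 1)"
    using assms \<alpha> by (intro powr_mono2') auto
  also have "\<dots> = 2 powr (1 - \<alpha>) * real (n + 1) powr (\<alpha> - 1)"
    by (simp add: powr_divide powr_diff)
  also have "\<dots> \<le> 2 powr 1 * (Gamma \<alpha> * mchoose \<alpha> n)"
    using \<alpha> mchoose_ge_powr[of \<alpha> n] by (intro mult_mono powr_mono) auto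
  finally have "\<alpha> * real n powr (\<alpha> - 1) \<le> \<alpha> * (2 * (Gamma \<alpha> * mchoose \<alpha> n))"
    using \<alpha> by (intro mult_left_mono) auto
  then show ?thesis by (simp add: pseudo_power_prob_def \<alpha>_def mult_ac)
qed

lemma lambda_const_pos: "s \<ge> 1 \<Longrightarrow> lambda_const s > 0"
  unfolding lambda_const_def
  by (intro divide_pos_pos mult_pos_pos zero_less_power Gamma_real_pos) auto

text \<open>With \<open>\<alpha> = 1 / s\<close>, the constant
  \<open>\<alpha> * Gamma \<alpha>\<close> enters once per summand, and its \<open>s\<close>-th
  power divided by \<open>fact s\<close> is \<open>lambda_const s\<close>. The error has parameter
  \<open>(s - 1) * \<alpha> < 1\<close>, hence vanishes in the limit.\<close>

lemma rep_weight_pseudo_power_lower: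
  assumes "s \<ge> 1" "c < lambda_const s"
  shows "\<forall>\<^sub>F m in sequentially. c \<le> rep_weight (pseudo_power_prob s) s m"
proof -
  define \<alpha> where "\<alpha> = 1 / real s"
  have \<alpha>: "0 < \<alpha>" "\<alpha> \<le> 1" using assms by (auto simp: \<alpha>_def)
  have G: "Gamma \<alpha> > 0" using \<alpha> by (intro Gamma_real_pos)
  obtain k where k: "s = Suc k" using assms by (cases s) auto
  have s\<alpha>: "real (Suc k) * \<alpha> = 1" by (simp add: \<alpha>_def k)
  obtain D where D: "\<And>m. fact s * rep_weight (mchoose \<alpha>) s m \<ge> 1 - D * mchoose (k * \<alpha>) m"
    using rep_weight_lower[OF \<alpha>, of k] unfolding s\<alpha> by (auto simp: k)
  have lam: "lambda_const s = (\<alpha> * Gamma \<alpha>) ^ s / fact s"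
    by (simp add: lambda_const_def \<alpha>_def power_mult_distrib power_divide)
  have low: "lambda_const s * (1 - D * mchoose (k * \<alpha>) m) \<le> rep_weight (pseudo_power_prob s) s m" for m
  proof -
    have "lambda_const s * (1 - D * mchoose (k * \<alpha>) m)
        \<le> lambda_const s * (fact s * rep_weight (mchoose \<alpha>) s m)"
      using D lambda_const_pos[OF assms(1)] by (intro mult_left_mono) auto
    also have "\<dots> = (\<alpha> * Gamma \<alpha>) ^ s * rep_weight (mchoose \<alpha>) s m"
      by (simp add: lam)
    also have "\<dots> \<le> rep_weight (pseudo_power_prob s) s m"
      using pseudo_power_prob_ge[OF assms(1)] \<alpha> G
      by (intro rep_weight_scale_mono) (auto simp: \<alpha>_def)
    finally show ?thesis .
  qed
  have "real k * \<alpha> < 1" by (simp add: \<alpha>_def k)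
  then have "(\<lambda>m. lambda_const s * (1 - D * mchoose (k * \<alpha>) m)) \<longlonglongrightarrow> lambda_const s * (1 - D * 0)"
    using \<alpha> by (intro tendsto_intros mchoose_tendsto_0) auto
  then have "\<forall>\<^sub>F m in sequentially. c < lambda_const s * (1 - D * mchoose (k * \<alpha>) m)"
    using assms(2) by (intro order_tendstoD(1)) auto
  then show ?thesis
    by eventually_elim (use low in \<open>meson less_imp_le order_trans\<close>)
qed

text \<open>For independent choices with probabilities \<open>w\<close>, the expected number of
  ordered pairs of distinct intersecting sets, of sums \<open>m\<close> and \<open>m'\<close>, that
  are both fully chosen.\<close>

definition overlap_weight :: "(nat \<Rightarrow> real) \<Rightarrow> nat \<Rightarrow> nat \<Rightarrow> nat \<Rightarrow> real" where
  "overlap_weight w s m m' =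
     (\<Sum>(S, S')\<in>{(S, S') \<in> sum_sets s m \<times> sum_sets s m'. S \<noteq> S' \<and> S \<inter> S' \<noteq> {}}. prod w (S \<union> S'))"

lemma overlap_weight_commute: "overlap_weight w s m m' = overlap_weight w s m' m"
  unfolding overlap_weight_def
  by (rule sum.reindex_bij_witness[of _ prod.swap prod.swap]) (auto simp: Un_commute)

text \<open>After \<open>rep_weight_upper\<close>, a common part of \<open>s - k\<close> elements
  has parameter \<open>1 - k * \<alpha>\<close> and each difference has \<open>k * \<alpha>\<close>,
  as in \<open>mchoose_triple_sum\<close>. The decay exponent \<open>\<alpha> / 2\<close> is
  admissible for every \<open>k\<close> from 1 to \<open>s - 1\<close>.\<close>

lemma overlap_weight_pseudo_power_upper:
  assumes "s \<ge> 1"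
  obtains C where "C > 0" "\<And>r m m'. r \<le> m \<Longrightarrow> r \<le> m' \<Longrightarrow>
    overlap_weight (pseudo_power_prob s) s m m' \<le> C * real (r + 1) powr (- (1 / (2 * real s)))"
proof -
  define \<alpha> where "\<alpha> = 1 / real s"
  have \<alpha>: "0 < \<alpha>" "\<alpha> \<le> 1" "real s * \<alpha> = 1" using assms by (auto simp: \<alpha>_def)
  define K where "K = 2 * \<alpha> * Gamma \<alpha>"
  have K: "K > 0" unfolding K_def using \<alpha> by (intro mult_pos_pos Gamma_real_pos) auto
  have up: "rep_weight (pseudo_power_prob s) k m \<le> K ^ k * mchoose (k * \<alpha>) m" for k m
    using \<alpha> K pseudo_power_prob_le[OF assms]
    by (intro rep_weight_upper) (auto simp: K_def \<alpha>_def)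
  have "\<exists>C>0. \<forall>m m'. m \<le> m' \<longrightarrow>
       (\<Sum>t\<le>m. mchoose (1 - k * \<alpha>) t * mchoose (k * \<alpha>) (m - t) * mchoose (k * \<alpha>) (m' - t))
         \<le> C * real (m + 1) powr (-(\<alpha> / 2))" if "k \<in> {1..<s}" for k
  proof -
    have "1 * \<alpha> \<le> real k * \<alpha>" using that \<alpha> by (intro mult_right_mono) auto
    moreover have "(real k + 1) * \<alpha> \<le> real s * \<alpha>" using that \<alpha> by (intro mult_right_mono) auto
    ultimately have "0 < \<alpha> / 2" "\<alpha> / 2 < k * \<alpha>" "k * \<alpha> + \<alpha> / 2 \<le> 1"
      using \<alpha> by (auto simp: distrib_right)
    then show ?thesis by (rule mchoose_triple_sum) blast
  qed
  then have "\<forall>k\<in>{1..<s}. \<exists>C. C > 0 \<and> (\<forall>m m'. m \<le> m' \<longrightarrow>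
       (\<Sum>t\<le>m. mchoose (1 - k * \<alpha>) t * mchoose (k * \<alpha>) (m - t) * mchoose (k * \<alpha>) (m' - t))
         \<le> C * real (m + 1) powr (-(\<alpha> / 2)))"
    by blast
  from bchoice[OF this] obtain C :: "nat \<Rightarrow> real" where C: "\<forall>k\<in>{1..<s}. C k > 0 \<and> (\<forall>m m'. m \<le> m' \<longrightarrow>
       (\<Sum>t\<le>m. mchoose (1 - k * \<alpha>) t * mchoose (k * \<alpha>) (m - t) * mchoose (k * \<alpha>) (m' - t))
         \<le> C k * real (m + 1) powr (-(\<alpha> / 2)))"
    by (elim exE)
  \<comment> \<open>The added 1 keeps \<open>E\<close> positive when the sum is empty, that is for
    \<open>s = 1\<close>.\<close>
  define E where "E = 1 + (\<Sum>k=1..<s. K ^ (s + k) * C k)"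
  have E: "E > 0" unfolding E_def using C K
    by (intro add_pos_nonneg sum_nonneg mult_nonneg_nonneg) (auto intro: less_imp_le)
  have ord: "overlap_weight (pseudo_power_prob s) s m m' \<le> E * real (m + 1) powr (-(\<alpha> / 2))"
    if "m \<le> m'" for m m'
  proof -
    let ?R = "rep_weight (pseudo_power_prob s)"
    have nn: "mchoose (real k * \<alpha>) j \<ge> 0" for k j using \<alpha> by simp
    have "overlap_weight (pseudo_power_prob s) s m m'
        \<le> (\<Sum>k=1..<s. \<Sum>t\<le>m. ?R (s - k) t * ?R k (m - t) * ?R k (m' - t))"
      unfolding overlap_weight_def using that by (intro overlapping_pairs_sum_le) auto
    also have "\<dots> \<le> (\<Sum>k=1..<s. K ^ (s + k) * (C k * real (m + 1) powr (-(\<alpha> / 2))))"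
    proof (intro sum_mono)
      fix k assume k: "k \<in> {1..<s}"
      then have sk: "real (s - k) * \<alpha> = 1 - k * \<alpha>"
        using \<alpha> by (simp add: of_nat_diff algebra_simps)
      have "s + k = (s - k) + k + k" using k by auto
      then have pow: "K ^ (s + k) = K ^ (s - k) * K ^ k * K ^ k"
        by (metis power_add)
      have "(\<Sum>t\<le>m. ?R (s - k) t * ?R k (m - t) * ?R k (m' - t))
         \<le> (\<Sum>t\<le>m. (K ^ (s - k) * mchoose ((s - k) * \<alpha>) t) * (K ^ k * mchoose (k * \<alpha>) (m - t))
               * (K ^ k * mchoose (k * \<alpha>) (m' - t)))"
        using K nn by (intro sum_mono mult_mono up)
          (auto intro!: rep_weight_nonneg mult_nonneg_nonneg)
      also have "\<dots> = K ^ (s + k) *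
          (\<Sum>t\<le>m. mchoose (1 - k * \<alpha>) t * mchoose (k * \<alpha>) (m - t) * mchoose (k * \<alpha>) (m' - t))"
        unfolding pow sk sum_distrib_left by (intro sum.cong refl) (simp only: mult_ac)
      also have "\<dots> \<le> K ^ (s + k) * (C k * real (m + 1) powr (-(\<alpha> / 2)))"
        using K C k that by (intro mult_left_mono) auto
      finally show "(\<Sum>t\<le>m. ?R (s - k) t * ?R k (m - t) * ?R k (m' - t))
        \<le> K ^ (s + k) * (C k * real (m + 1) powr (-(\<alpha> / 2)))" .
    qed
    also have "\<dots> = (E - 1) * real (m + 1) powr (-(\<alpha> / 2))"
      by (simp add: E_def sum_distrib_right mult.assoc)
    also have "\<dots> \<le> E * real (m + 1) powr (-(\<alpha> / 2))"
      by (intro mult_right_mono) auto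
    finally show ?thesis .
  qed
  show ?thesis
  proof
    show "E > 0" by (rule E)
    fix r m m' :: nat assume r: "r \<le> m" "r \<le> m'"
    have "overlap_weight (pseudo_power_prob s) s m m' \<le> E * real (min m m' + 1) powr (-(\<alpha> / 2))"
      using ord[of m m'] ord[of m' m] by (cases "m \<le> m'") (auto simp: overlap_weight_commute min_def)
    also have "\<dots> \<le> E * real (r + 1) powr (-(\<alpha> / 2))"
      using r E \<alpha> by (intro mult_left_mono powr_mono2') auto
    finally show "overlap_weight (pseudo_power_prob s) s m m' \<le> E * real (r + 1) powr (- (1 / (2 * real s)))"
      by (simp add: \<alpha>_def mult.commute)
  qed
qed

text \<open>Janson's inequality for all candidate sets at once. Distinct \<open>b\<close> give
  distinct sums \<open>n - b\<close>, so the families are disjoint and both sums in the exponent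
  split according to \<open>b\<close>.\<close>

lemma prob_no_representation_le:
  fixes M :: "'a measure"
  assumes s: "s \<ge> 1" and pseudo: "pseudo_power_indicators s M \<xi>" and X: "finite X" "\<And>b. b \<in> X \<Longrightarrow> b \<le> n"
  defines "F \<equiv> (\<Union>b\<in>X. sum_sets s (n - b))"
  shows "measure M (prob_space.none_all_true M \<xi> F) \<le>
    exp (- (\<Sum>b\<in>X. rep_weight (pseudo_power_prob s) s (n - b)) +
      (\<Sum>(b, b')\<in>X \<times> X. overlap_weight (pseudo_power_prob s) s (n - b) (n - b')))"
proof -
  interpret prob_space M using pseudo by (simp add: pseudo_power_indicators_def)
  have indep: "indep_vars (\<lambda>_. count_space UNIV) \<xi> {1..}"
    using pseudo by (simp add: pseudo_power_indicators_def)
  have p: "prob {\<omega> \<in> space M. \<xi> i \<omega>} = pseudo_power_prob s i" if "i \<ge> 1" for i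
  proof -
    have "prob {\<omega> \<in> space M. \<xi> i \<omega>} = measure (distr M (count_space UNIV) (\<xi> i)) {True}"
      using that measurable_indicator[OF indep, of i]
      by (subst measure_distr) (auto intro!: arg_cong[of _ _ prob])
    also have "\<dots> = measure (measure_pmf (bernoulli_pmf (pseudo_power_prob s i))) {True}"
      using pseudo that by (simp add: pseudo_power_indicators_def pseudo_power_prob_def)
    also have "\<dots> = pseudo_power_prob s i"
      using that pseudo_power_prob_le_1[of s i] s by (simp add: measure_pmf_single)
    finally show ?thesis .
  qed
  have prob_S: "prob (all_true \<xi> S) = prod (pseudo_power_prob s) S" if "finite S" "S \<subseteq> {1..}" for S
    unfolding prob_all_true[OF indep that] using that p by (intro prod.cong) auto
  have F: "finite F" "\<And>S. S \<in> F \<Longrightarrow> finite S \<and> S \<subseteq> {1..}"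
    unfolding F_def using X sum_sets_finite_pos by (auto, force)
  have inj: "n - b \<noteq> n - b'" if "b \<in> X" "b' \<in> X" "b \<noteq> b'" for b b'
    using X(2)[OF that(1)] X(2)[OF that(2)] that(3) by linarith
  have dis: "b = b'" if "b \<in> X" "b' \<in> X" "S \<in> sum_sets s (n - b)" "S \<in> sum_sets s (n - b')" for b b' S
    using inj[of b b'] that by (auto simp: sum_sets_def)
  have "prob (none_all_true \<xi> F) \<le> exp (- (\<Sum>S\<in>F. prob (all_true \<xi> S)) +
    (\<Sum>(S, S')\<in>{(S, S') \<in> F \<times> F. S \<noteq> S' \<and> S \<inter> S' \<noteq> {}}. prob (all_true \<xi> (S \<union> S'))))"
    using F by (intro Janson_inequality[OF indep]) auto
  also have "(\<Sum>S\<in>F. prob (all_true \<xi> S)) = (\<Sum>S\<in>F. prod (pseudo_power_prob s) S)"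
    using F prob_S by (intro sum.cong) auto
  also have "\<dots> = (\<Sum>b\<in>X. rep_weight (pseudo_power_prob s) s (n - b))"
    unfolding F_def rep_weight_def using X dis
    by (intro sum.UNION_disjoint) auto
  also have "(\<Sum>(S, S')\<in>{(S, S') \<in> F \<times> F. S \<noteq> S' \<and> S \<inter> S' \<noteq> {}}. prob (all_true \<xi> (S \<union> S')))
     = (\<Sum>(S, S')\<in>{(S, S') \<in> F \<times> F. S \<noteq> S' \<and> S \<inter> S' \<noteq> {}}. prod (pseudo_power_prob s) (S \<union> S'))"
    using F prob_S by (intro sum.cong) auto
  also have "{(S, S') \<in> F \<times> F. S \<noteq> S' \<and> S \<inter> S' \<noteq> {}} = (\<Union>(b, b')\<in>X \<times> X.
      {(S, S') \<in> sum_sets s (n - b) \<times> sum_sets s (n - b'). S \<noteq> S' \<and> S \<inter> S' \<noteq> {}})"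
    by (auto simp: F_def)
  also have "(\<Sum>(S, S')\<in>\<dots>. prod (pseudo_power_prob s) (S \<union> S')) =
      (\<Sum>(b, b')\<in>X \<times> X. overlap_weight (pseudo_power_prob s) s (n - b) (n - b'))"
    unfolding overlap_weight_def
  proof (subst sum.UNION_disjoint)
    show "\<forall>i\<in>X \<times> X. finite (case i of (b, b') \<Rightarrow>
        {(S, S') \<in> sum_sets s (n - b) \<times> sum_sets s (n - b'). S \<noteq> S' \<and> S \<inter> S' \<noteq> {}})"
      by (auto intro: finite_subset[OF _ finite_cartesian_product[OF finite_sum_sets finite_sum_sets]])
  qed (use X in \<open>auto dest: dis intro!: sum.cong\<close>)
  finally show ?thesis .
qed

theorem theorem2:
  fixes s :: nat and B :: "nat set" and M :: "'a measure" and \<xi> :: "nat \<Rightarrow> 'a \<Rightarrow> bool"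
  assumes "s \<ge> 2"
    and "liminf (\<lambda>n. ereal (real (counting_fun B n) / ln (real n))) > ereal (inverse (lambda_const s))"
    and "pseudo_power_indicators s M \<xi>"
  shows "AE \<omega> in M. \<forall>\<^sub>F n in sequentially.
           \<exists>a :: nat \<Rightarrow> nat. \<exists>b\<in>B.
             inj_on a {1..s} \<and> (\<forall>i\<in>{1..s}. a i \<in> random_seq \<xi> \<omega>) \<and>
             n = (\<Sum>i=1..s. a i) + b"
proof -
  interpret prob_space M using assms(3) by (simp add: pseudo_power_indicators_def)
  have indep: "indep_vars (\<lambda>_. count_space UNIV) \<xi> {1..}"
    using assms(3) by (simp add: pseudo_power_indicators_def)
  have s: "s \<ge> 1" using assms(1) by simp
  have lam: "lambda_const s > 0" using s by (rule lambda_const_pos)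

  obtain c' where c': "inverse (lambda_const s) < c'"
    "\<forall>\<^sub>F n in sequentially. c' < real (counting_fun B n) / ln (real n)"
  proof -
    obtain c' where "ereal (inverse (lambda_const s)) < ereal c'"
      "ereal c' < liminf (\<lambda>n. ereal (real (counting_fun B n) / ln (real n)))"
      using ereal_dense2[OF assms(2)] by blast
    then show ?thesis using that less_LiminfD by fastforce
  qed
  have "c' > 0" using c'(1) lam by (smt (verit) inverse_positive_iff_positive)
  have "inverse c' < lambda_const s"
    using c'(1) lam \<open>c' > 0\<close> by (metis inverse_inverse_eq inverse_less_iff_less inverse_positive_iff_positive)
  \<comment> \<open>The slack in the hypothesis is divided up: \<open>c\<close> bounds the expected
    count for each \<open>b\<close> from below, \<open>d * ln n\<close> is the number of
    \<open>b\<close> used, and \<open>c * d > 1\<close> makes the final bound summable. The gap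
    between \<open>d\<close> and \<open>c'\<close> absorbs rounding and the halving of
    \<open>n\<close>.\<close>
  then obtain c where c: "inverse c' < c" "c < lambda_const s" using dense by blast
  have "c > 0" using c \<open>c' > 0\<close> by (smt (verit) inverse_positive_iff_positive)
  have "inverse c < c'"
    using c(1) \<open>c > 0\<close> \<open>c' > 0\<close> by (metis inverse_inverse_eq inverse_less_iff_less inverse_positive_iff_positive)
  then obtain d where d: "inverse c < d" "d < c'" using dense by blast
  have "d > 0" using d \<open>c > 0\<close> by (smt (verit) inverse_positive_iff_positive)
  have cd: "c * d > 1" using d(1) \<open>c > 0\<close> by (simp add: field_simps)

  obtain C where C: "C > 0" "\<And>r m m'. r \<le> m \<Longrightarrow> r \<le> m' \<Longrightarrow>
    overlap_weight (pseudo_power_prob s) s m m' \<le> C * real (r + 1) powr (- (1 / (2 * real s)))"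
    using overlap_weight_pseudo_power_upper[OF s] by blast
  define \<delta> where "\<delta> = 1 / (2 * real s)"
  have "\<delta> > 0" using s by (simp add: \<delta>_def)

  \<comment> \<open>Restricting to \<open>b \<le> n div 2\<close> keeps every \<open>n - b\<close>
    at least \<open>n / 2\<close>, so that the asymptotic bounds hold uniformly in
    \<open>b\<close>.\<close>
  define Bn where "Bn n = {b \<in> B. b \<le> n div 2}" for n
  define F where "F n = (\<Union>b\<in>Bn n. sum_sets s (n - b))" for n
  define bad where "bad n = none_all_true \<xi> (F n)" for n
  have F: "finite (F n)" for n
    by (simp add: F_def Bn_def)
  have F_sets: "finite S \<and> S \<subseteq> {1..}" if "S \<in> F n" for S n
    using that sum_sets_finite_pos unfolding F_def by blast
  have bad_sets: "bad n \<in> events" for n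
    unfolding bad_def using F F_sets by (intro none_all_true_sets[OF indep]) auto

  have half: "filterlim (\<lambda>n :: nat. n div 2) sequentially sequentially"
    by (rule filterlim_at_top_div_const_nat) simp
  have ev_B: "\<forall>\<^sub>F n in sequentially. c' < real (counting_fun B (n div 2)) / ln (real (n div 2))"
    using filterlim_iff[THEN iffD1, OF half] c'(2) by blast
  obtain m0 where m0: "\<And>m. m \<ge> m0 \<Longrightarrow> c \<le> rep_weight (pseudo_power_prob s) s m"
    using rep_weight_pseudo_power_lower[OF s c(2)] by (auto simp: eventually_sequentially)
  \<comment> \<open>The \<open>+ 1\<close> pays for rounding \<open>d * ln n\<close> up to an
    integer; \<open>n / 3\<close> is a lower bound for \<open>n div 2\<close>.\<close>
  have ev_ln: "\<forall>\<^sub>F n :: nat in sequentially. d * ln n + 1 \<le> c' * ln (n / 3)"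
    using d \<open>d > 0\<close> by real_asymp
  have ev_small: "\<forall>\<^sub>F n :: nat in sequentially. (d * ln n + 1)\<^sup>2 * (C * (real n / 2) powr (-\<delta>)) \<le> 1"
    using \<open>\<delta> > 0\<close> \<open>d > 0\<close> \<open>C > 0\<close> by real_asymp

  have "\<forall>\<^sub>F n in sequentially. norm (prob (bad n)) \<le> exp 1 * real n powr (- (c * d))"
    \<comment> \<open>The 4 makes \<open>ln (n div 2)\<close> positive, so that it can be multiplied
      out; \<open>2 * m0\<close> ensures \<open>n - b \<ge> m0\<close>.\<close>
    using ev_B ev_ln ev_small eventually_ge_at_top[of "2 * m0 + 4"]
  proof eventually_elim
    case (elim n)
    have n: "n \<ge> 4" "n \<ge> 2 * m0" using elim(4) by auto
    define N where "N = nat \<lceil>d * ln n\<rceil>"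
    have lnn: "ln (real n) \<ge> 0" using n by simp
    have "d * ln n \<ge> 0" using lnn \<open>d > 0\<close> by simp
    then have "real N = of_int \<lceil>d * ln n\<rceil>" unfolding N_def by linarith
    then have N: "d * ln n \<le> real N" "real N \<le> d * ln n + 1" by linarith+
    have "real N \<le> c' * ln (n / 3)" using N elim by linarith
    also have "\<dots> \<le> c' * ln (real (n div 2))"
    proof (intro mult_left_mono ln_mono)
      show "real n / 3 \<le> real (n div 2)" using n by linarith
    qed (use n \<open>c' > 0\<close> in auto)
    also have "\<dots> \<le> real (counting_fun B (n div 2))"
      using elim(1) n by (simp add: pos_less_divide_eq)
    finally have "N \<le> card (Bn n)" by (simp add: counting_fun_def Bn_def)
    \<comment> \<open>Since \<open>B\<close> may be much denser than logarithmic, only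
      \<open>N\<close> elements are kept; otherwise the overlap sum, with one term per pair, could
      be large. Using fewer \<open>b\<close> only enlarges the event of failure.\<close>
    then obtain X where X: "X \<subseteq> Bn n" "card X = N" "finite X"
      by (metis obtain_subset_with_card_n)
    have Xn: "b \<le> n div 2" if "b \<in> X" for b using X that by (auto simp: Bn_def)
    have Xn': "n - n div 2 \<le> n - b" "b \<le> n" if "b \<in> X" for b using Xn[OF that] by auto
    have "prob (bad n) \<le> prob (none_all_true \<xi> (\<Union>b\<in>X. sum_sets s (n - b)))"
    proof (intro finite_measure_mono none_all_true_sets[OF indep])
      show "bad n \<subseteq> none_all_true \<xi> (\<Union>b\<in>X. sum_sets s (n - b))"
        using X unfolding bad_def F_def none_all_true_def by blast
      show "finite S \<and> S \<subseteq> {1..}" if "S \<in> (\<Union>b\<in>X. sum_sets s (n - b))" for S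
        using that sum_sets_finite_pos by blast
    qed (use X in simp)
    also have "\<dots> \<le> exp (- (\<Sum>b\<in>X. rep_weight (pseudo_power_prob s) s (n - b)) +
      (\<Sum>(b, b')\<in>X \<times> X. overlap_weight (pseudo_power_prob s) s (n - b) (n - b')))"
      using s assms(3) X Xn' by (intro prob_no_representation_le) auto
    also have "\<dots> \<le> exp (- (c * d) * ln n + 1)"
    proof -
      have "c * d * ln n \<le> real N * c" using N(1) \<open>c > 0\<close> by (simp add: mult.assoc mult.commute)
      also have "\<dots> = (\<Sum>b\<in>X. c)" using X by simp
      also have "\<dots> \<le> (\<Sum>b\<in>X. rep_weight (pseudo_power_prob s) s (n - b))"
      proof (intro sum_mono m0)
        show "n - b \<ge> m0" if "b \<in> X" for b using Xn[OF that] n by linarith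
      qed
      finally have mu: "c * d * ln n \<le> (\<Sum>b\<in>X. rep_weight (pseudo_power_prob s) s (n - b))" .
      have "(\<Sum>(b, b')\<in>X \<times> X. overlap_weight (pseudo_power_prob s) s (n - b) (n - b'))
         \<le> (\<Sum>(b, b')\<in>X \<times> X. C * (real n / 2) powr (-\<delta>))"
      proof (intro sum_mono, clarify)
        fix b b' assume b: "b \<in> X" "b' \<in> X"
        have "overlap_weight (pseudo_power_prob s) s (n - b) (n - b')
            \<le> C * real (n - n div 2 + 1) powr (-\<delta>)"
          unfolding \<delta>_def using Xn' b by (intro C(2)) auto
        also have "\<dots> \<le> C * (real n / 2) powr (-\<delta>)"
          using C(1) \<open>\<delta> > 0\<close> n by (intro mult_left_mono powr_mono2') linarith+
        finally show "overlap_weight (pseudo_power_prob s) s (n - b) (n - b') \<le> C * (real n / 2) powr (-\<delta>)" .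
      qed
      also have "\<dots> = (real N)\<^sup>2 * (C * (real n / 2) powr (-\<delta>))"
        using X by (simp add: card_cartesian_product power2_eq_square case_prod_unfold)
      also have "\<dots> \<le> (d * ln n + 1)\<^sup>2 * (C * (real n / 2) powr (-\<delta>))"
        using N(2) C(1) by (intro mult_right_mono power_mono) auto
      also have "\<dots> \<le> 1" by (rule elim(3))
      finally show ?thesis using mu by simp
    qed
    also have "\<dots> = exp 1 * real n powr (- (c * d))"
      using n by (simp add: powr_def exp_diff exp_minus field_simps)
    finally show ?case by simp
  qed
  moreover have "summable (\<lambda>n. exp 1 * real n powr (- (c * d)))"
    using cd by (intro summable_mult) (simp add: summable_real_powr_iff)
  ultimately have "summable (\<lambda>n. prob (bad n))"
    by (rule summable_comparison_test_ev)
  then have "AE \<omega> in M. \<forall>\<^sub>F n in sequentially. \<omega> \<in> space M - bad n"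
    using bad_sets by (intro borel_cantelli_AE1) (auto simp: emeasure_eq_measure)
  then show ?thesis
  proof (rule AE_mp, intro AE_I2 impI)
    fix \<omega> assume "\<forall>\<^sub>F n in sequentially. \<omega> \<in> space M - bad n"
    then show "\<forall>\<^sub>F n in sequentially. \<exists>a :: nat \<Rightarrow> nat. \<exists>b\<in>B.
             inj_on a {1..s} \<and> (\<forall>i\<in>{1..s}. a i \<in> random_seq \<xi> \<omega>) \<and> n = (\<Sum>i=1..s. a i) + b"
    proof eventually_elim
      case (elim n)
      then obtain b S where b: "b \<in> B" "b \<le> n div 2" and S: "S \<in> sum_sets s (n - b)" "\<forall>i\<in>S. \<xi> i \<omega>"
        by (auto simp: bad_def none_all_true_def F_def Bn_def)
      have S': "finite S" "card S = s" "\<Sum>S = n - b" using S by (auto simp: sum_sets_def)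
      \<comment> \<open>An enumeration of the set \<open>S\<close> supplies the summands as an
        injective family indexed by \<open>{1..s}\<close>.\<close>
      then obtain a where a: "bij_betw a {1..s} S"
        using ex_bij_betw_nat_finite_1[of S] by auto
      have "(\<Sum>i=1..s. a i) = \<Sum>S"
        using sum.reindex_bij_betw[OF a, of "\<lambda>x. x"] by simp
      then have "n = (\<Sum>i=1..s. a i) + b" using S' b by simp
      moreover have "a i \<in> random_seq \<xi> \<omega>" if "i \<in> {1..s}" for i
        using bij_betwE[OF a] that S sum_sets_pos[OF S(1), of "a i"] by (auto simp: random_seq_def)
      ultimately show ?case using a b(1) by (auto simp: bij_betw_def)
    qed
  qed
qed

end
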